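(* Let $\Gamma$ be a Coxeter graph with finite vertex set $S$, and let $X\subseteq S$. If the word problem in $\mathrm{VA}[\Gamma]$ is solvable, then the strong membership problem for $\mathrm{VA}_X[\Gamma]$ in $\mathrm{VA}[\Gamma]$ is solvable.
   Context: A Coxeter matrix over a finite set $S$ is a symmetric matrix $M=(m_{s,t})_{s,t\in S}$ with entries in $\mathbb{N}_{\ge 1}\cup\{\infty\}$, such that $m_{s,s}=1$ for all $s$ and $m_{s,t}=m_{t,s}\ge 2$ for all $s\neq t$. Its Coxeter graph $\Gamma$ has vertex set $S$; distinct $s,t$ are joined by an edge iff $m_{s,t}\ge 3$, and the edge is labeled by $m_{s,t}$ if $m_{s,t}\ge 4$. Thus $\Gamma$ and $M$ determine each other. For letters $a,b$ and an integer $m\geq 1$, $\Pi(a,b,m)$ denotes the alternating product $aba\cdots$ of length $m$. The virtual Artin group $\mathrm{VA}[\Gamma]$ is the group generated by $\mathcal{S}\sqcup\mathcal{T}$, where $\mathcal{S}=\{\sigma_s\mid s\in S\}$ and $\mathcal{T}=\{\tau_s\mid s\in S\}$ are in one-to-one correspondence with $S$, subject to the relations: (v1) $\Pi(\sigma_s,\sigma_t,m_{s,t})=\Pi(\sigma_t,\sigma_s,m_{s,t})$ for $s\ne t$ with $m_{s,t}\ne\infty$; (v2) $\tau_s^2=1$ for $s\in S$, and $\Pi(\tau_s,\tau_t,m_{s,t})=\Pi(\tau_t,\tau_s,m_{s,t})$ for $s\ne t$ with $m_{s,t}\neq\infty$; (v3) $\sigma_s\,\Pi(\tau_t,\tau_s,m_{s,t}-1)=\Pi(\tau_t,\tau_s,m_{s,t}-1)\,\sigma_r$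 for $s\neq t$ with $m_{s,t}\ne\infty$, where $r=s$ if $m_{s,t}$ is even and $r=t$ if $m_{s,t}$ is odd. For $X\subseteq S$, $\mathrm{VA}_X[\Gamma]$ denotes the subgroup of $\mathrm{VA}[\Gamma]$ generated by $\{\sigma_x\mid x\in X\}\sqcup\{\tau_x\mid x\in X\}$. For a group $G$ with generating set $S_G$ and a word $\omega$ over $S_G\sqcup S_G^{-1}$, $\overline{\omega}$ denotes the element of $G$ represented by $\omega$. The word problem in $G$ (with $S_G$ finite) is solvable if there is an algorithm that, given a word $\omega$ over $S_G\sqcup S_G^{-1}$, decides whether $\overline{\omega}=1$. If $H$ is a subgroup of $G$ and $S_G$, $S_H$ are finite generating sets of $G$, $H$ respectively, the strong membership problem for $H$ in $G$ is solvable if there is an algorithm that, given a word $\omega$ over $S_G\sqcup S_G^{-1}$, decides whether $\overline{\omega}\in H$ and, if so, determines a word $\mu$ over $S_H\sqcup S_H^{-1}$ such that $\overline{\mu}=\overline{\omega}$. *)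

theory Defs
  imports
    "HOL-Algebra.Generated_Groups"
    "HOL-Library.Extended_Nat"
    "HOL-Library.Nat_Bijection"
    "HOL-Library.Countable_Set"
begin

section \<open>Algorithms: partial recursive functions\<close>

text \<open>
  Algorithms are Kleene's \<open>\<mu>\<close>-recursive programs, with a relational semantics:
  \<open>computes p xs y\<close> means that \<open>p\<close> halts on the argument list \<open>xs\<close> with output \<open>y\<close>.
  The recursion argument of \<open>PrimRec\<close> and the search argument of \<open>Mu\<close> come first.
\<close>

datatype recf =
    Zero
  | Succ
  | Proj nat
  | Comp recf "recf list"
  | PrimRec recf recf
  | Mu recf

inductive computes :: "recf \<Rightarrow> nat list \<Rightarrow> nat \<Rightarrow> bool" where
  Zero: "computes Zero xs 0"
| Succ: "computes Succ [x] (Suc x)"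
| Proj: "i < length xs \<Longrightarrow> computes (Proj i) xs (xs ! i)"
| Comp: "length ys = length gs \<Longrightarrow> (\<forall>i<length gs. computes (gs ! i) xs (ys ! i)) \<Longrightarrow>
    computes f ys z \<Longrightarrow> computes (Comp f gs) xs z"
| PrimRec_0: "computes f xs y \<Longrightarrow> computes (PrimRec f g) (0 # xs) y"
| PrimRec_Suc: "computes (PrimRec f g) (n # xs) y \<Longrightarrow> computes g (n # y # xs) z \<Longrightarrow>
    computes (PrimRec f g) (Suc n # xs) z"
| Mu: "computes f (n # xs) 0 \<Longrightarrow> (\<forall>m<n. \<exists>y. computes f (m # xs) (Suc y)) \<Longrightarrow>
    computes (Mu f) xs n"

lemma computes_deterministic:
  assumes "computes p xs y" "computes p xs y'"
  shows "y = y'"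
  using assms
proof (induction arbitrary: y' rule: computes.induct)
  case (Comp ys gs xs f z)
  from Comp.prems obtain ys' where ys': "length ys' = length gs"
    "\<forall>i<length gs. computes (gs ! i) xs (ys' ! i)" "computes f ys' y'"
    by (cases rule: computes.cases) auto
  have "ys = ys'"
    using Comp.hyps(1) Comp.IH(1) ys' by (intro nth_equalityI) auto
  then show ?case using Comp.IH(2) ys'(3) by blast
next
  case (PrimRec_Suc f g n xs y z)
  from PrimRec_Suc.prems obtain u where "computes (PrimRec f g) (n # xs) u" "computes g (n # u # xs) y'"
    by (cases rule: computes.cases) auto
  then show ?case using PrimRec_Suc.IH by blast
next
  case (Mu f n xs)
  from Mu.prems have 1: "computes f (y' # xs) 0" "\<forall>m<y'. \<exists>y. computes f (m # xs) (Suc y)"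
    by (cases rule: computes.cases; auto)+
  show ?case
  proof (cases n y' rule: linorder_cases)
    case less
    then show ?thesis using 1(2) Mu.IH(1) by blast
  next
    case greater
    then show ?thesis using 1(1) Mu.IH(2) by blast
  qed
next
  case (Zero xs)
  then show ?case by (cases rule: computes.cases) auto
next
  case (Succ x)
  then show ?case by (cases rule: computes.cases) auto
next
  case (Proj i xs)
  from Proj.prems show ?case by (cases rule: computes.cases) auto
next
  case (PrimRec_0 f xs y g)
  from PrimRec_0.prems have "computes f xs y'"
    by (cases rule: computes.cases) auto
  then show ?case using PrimRec_0.IH by blast
qed


section \<open>Words over a set of generators and its inverses\<close>

text \<open>The letter \<open>(a, True)\<close> stands for \<open>a\<close> and \<open>(a, False)\<close> for its formal inverse.\<close>

definition words :: "'a set \<Rightarrow> ('a \<times> bool) list set" where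
  "words A = lists (A \<times> UNIV)"

definition letter_val :: "('a, 'b) monoid_scheme \<Rightarrow> 'a \<times> bool \<Rightarrow> 'a" where
  "letter_val G l = (if snd l then fst l else inv\<^bsub>G\<^esub> (fst l))"

definition word_val :: "('a, 'b) monoid_scheme \<Rightarrow> ('a \<times> bool) list \<Rightarrow> 'a" where
  "word_val G w = foldr (\<lambda>l g. letter_val G l \<otimes>\<^bsub>G\<^esub> g) w \<one>\<^bsub>G\<^esub>"

text \<open>
  Words over a finite alphabet \<open>A\<close> are handed to programs as natural numbers. The bijection
  \<open>to_nat_on A\<close> from \<open>A\<close> to \<open>{..<card A}\<close> fixes a numbering of the alphabet; as \<open>A\<close> is finite,
  passing to another numbering is computable, so its choice is irrelevant for solvability.
\<close>

definition word_code :: "'a set \<Rightarrow> ('a \<times> bool) list \<Rightarrow> nat" where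
  "word_code A w = list_encode (map (\<lambda>(a, e). 2 * to_nat_on A a + of_bool e) w)"


section \<open>Decision problems\<close>

text \<open>
  In both definitions \<open>A\<close> is meant to be a finite generating set of the group \<open>G\<close>, and \<open>B\<close>
  a finite generating set of its subgroup \<open>H\<close>. For strong membership the output \<open>0\<close> is the
  answer ``not in \<open>H\<close>'', and \<open>Suc (word_code B v)\<close> is the answer ``in \<open>H\<close>, represented by \<open>v\<close>''.
\<close>

definition word_problem_solvable :: "('a, 'b) monoid_scheme \<Rightarrow> 'a set \<Rightarrow> bool" where
  "word_problem_solvable G A \<longleftrightarrow>
    (\<exists>p. \<forall>w \<in> words A.
      computes p [word_code A w] (if word_val G w = \<one>\<^bsub>G\<^esub> then 1 else 0))"

definition strong_membership_solvable ::
    "('a, 'b) monoid_scheme \<Rightarrow> 'a set \<Rightarrow> 'a set \<Rightarrow> 'a set \<Rightarrow> bool" where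
  "strong_membership_solvable G A H B \<longleftrightarrow>
    (\<exists>p. \<forall>w \<in> words A.
      (word_val G w \<in> H \<longrightarrow>
        (\<exists>v \<in> words B. word_val G v = word_val G w \<and>
          computes p [word_code A w] (Suc (word_code B v)))) \<and>
      (word_val G w \<notin> H \<longrightarrow> computes p [word_code A w] 0))"


section \<open>Groups given by generators and relations\<close>

inductive_set pres_cong ::
    "'g set \<Rightarrow> (('g \<times> bool) list \<times> ('g \<times> bool) list) set \<Rightarrow>
      (('g \<times> bool) list \<times> ('g \<times> bool) list) set"
  for A :: "'g set" and R :: "(('g \<times> bool) list \<times> ('g \<times> bool) list) set" where
  refl: "u \<in> words A \<Longrightarrow> (u, u) \<in> pres_cong A R"
| sym: "(u, v) \<in> pres_cong A R \<Longrightarrow> (v, u) \<in> pres_cong A R"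
| trans: "(u, v) \<in> pres_cong A R \<Longrightarrow> (v, w) \<in> pres_cong A R \<Longrightarrow> (u, w) \<in> pres_cong A R"
| rel: "(u, v) \<in> R \<Longrightarrow> u \<in> words A \<Longrightarrow> v \<in> words A \<Longrightarrow> p \<in> words A \<Longrightarrow> q \<in> words A \<Longrightarrow>
    (p @ u @ q, p @ v @ q) \<in> pres_cong A R"
| cancel: "a \<in> A \<Longrightarrow> p \<in> words A \<Longrightarrow> q \<in> words A \<Longrightarrow>
    (p @ [(a, e), (a, \<not> e)] @ q, p @ q) \<in> pres_cong A R"

definition presented_group ::
    "'g set \<Rightarrow> (('g \<times> bool) list \<times> ('g \<times> bool) list) set \<Rightarrow> ('g \<times> bool) list set monoid" where
  "presented_group A R =
    \<lparr>carrier = words A // pres_cong A R,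
     mult = (\<lambda>U V. \<Union>u\<in>U. \<Union>v\<in>V. pres_cong A R `` {u @ v}),
     one = pres_cong A R `` {[]}\<rparr>"

lemma words_simps [simp]:
  "[] \<in> words A"
  "l # w \<in> words A \<longleftrightarrow> fst l \<in> A \<and> w \<in> words A"
  "u @ v \<in> words A \<longleftrightarrow> u \<in> words A \<and> v \<in> words A"
  by (auto simp: words_def mem_Times_iff)

lemma words_map_rev [simp]: "map (apsnd f) (rev w) \<in> words A \<longleftrightarrow> w \<in> words A"
  by (induction w) auto

lemma pres_cong_words: "(u, v) \<in> pres_cong A R \<Longrightarrow> u \<in> words A \<and> v \<in> words A"
  by (induction rule: pres_cong.induct) auto

lemma equiv_pres_cong: "equiv (words A) (pres_cong A R)"
proof (rule equivI)
  show "pres_cong A R \<subseteq> words A \<times> words A" by (auto dest: pres_cong_words)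
  show "refl_on (words A) (pres_cong A R)" by (simp add: refl_on_def pres_cong.refl)
  show "sym (pres_cong A R)" by (rule symI) (rule pres_cong.sym)
  show "trans (pres_cong A R)" by (rule transI) (rule pres_cong.trans)
qed

lemma pres_cong_append_left:
  "(u, v) \<in> pres_cong A R \<Longrightarrow> x \<in> words A \<Longrightarrow> (x @ u, x @ v) \<in> pres_cong A R"
proof (induction rule: pres_cong.induct)
  case (rel u v p q)
  then show ?case using pres_cong.rel[of u v R A "x @ p" q] by simp
next
  case (cancel a p q e)
  then show ?case using pres_cong.cancel[of a A "x @ p" q e R] by simp
next
  case (refl u)
  then show ?case by (simp add: pres_cong.refl)
next
  case (sym u v)
  then show ?case by (blast intro: pres_cong.sym)
next
  case (trans u v w)
  then show ?case by (meson pres_cong.trans)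
qed

lemma pres_cong_append_right:
  "(u, v) \<in> pres_cong A R \<Longrightarrow> x \<in> words A \<Longrightarrow> (u @ x, v @ x) \<in> pres_cong A R"
proof (induction rule: pres_cong.induct)
  case (rel u v p q)
  then show ?case using pres_cong.rel[of u v R A p "q @ x"] by simp
next
  case (cancel a p q e)
  then show ?case using pres_cong.cancel[of a A p "q @ x" e R] by simp
next
  case (refl u)
  then show ?case by (simp add: pres_cong.refl)
next
  case (sym u v)
  then show ?case by (blast intro: pres_cong.sym)
next
  case (trans u v w)
  then show ?case by (meson pres_cong.trans)
qed

lemma pres_cong_append:
  "(u, u') \<in> pres_cong A R \<Longrightarrow> (v, v') \<in> pres_cong A R \<Longrightarrow> (u @ v, u' @ v') \<in> pres_cong A R"
  by (meson pres_cong.trans pres_cong_append_left pres_cong_append_right pres_cong_words)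

lemma pres_cong_class_eq_iff:
  "u \<in> words A \<Longrightarrow> v \<in> words A \<Longrightarrow>
    pres_cong A R `` {u} = pres_cong A R `` {v} \<longleftrightarrow> (u, v) \<in> pres_cong A R"
  by (metis equiv_pres_cong eq_equiv_class_iff)

lemma carrier_presented_group:
  "carrier (presented_group A R) = (\<lambda>w. pres_cong A R `` {w}) ` words A"
  by (auto simp: presented_group_def quotient_def)

lemma one_presented_group: "\<one>\<^bsub>presented_group A R\<^esub> = pres_cong A R `` {[]}"
  by (simp add: presented_group_def)

lemma mult_presented_group:
  assumes "u \<in> words A" "v \<in> words A"
  shows "pres_cong A R `` {u} \<otimes>\<^bsub>presented_group A R\<^esub> pres_cong A R `` {v} = pres_cong A R `` {u @ v}"
proof -
  have eq: "pres_cong A R `` {u' @ v'} = pres_cong A R `` {u @ v}"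
    if "u' \<in> pres_cong A R `` {u}" "v' \<in> pres_cong A R `` {v}" for u' v'
    by (rule equiv_class_eq[OF equiv_pres_cong, symmetric])
      (use that in \<open>simp add: pres_cong_append\<close>)
  have mem: "u \<in> pres_cong A R `` {u}" "v \<in> pres_cong A R `` {v}"
    using assms by (simp_all add: pres_cong.refl)
  show ?thesis
    unfolding presented_group_def monoid.simps
    by (intro UN_constant_eq[OF mem(1)] UN_constant_eq[OF mem(2)] ballI eq)
qed

lemma pres_cong_inverse:
  "w \<in> words A \<Longrightarrow> (map (apsnd Not) (rev w) @ w, []) \<in> pres_cong A R"
proof (induction w)
  case Nil
  then show ?case by (simp add: pres_cong.refl)
next
  case (Cons l w)
  obtain a e where l: "l = (a, e)" by (cases l)
  have w: "w \<in> words A" "a \<in> A" using Cons.prems l by auto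
  have "map (apsnd Not) (rev w) \<in> words A"
    using w by simp
  then have "(map (apsnd Not) (rev w) @ [(a, \<not> e), (a, \<not> \<not> e)] @ w, map (apsnd Not) (rev w) @ w)
      \<in> pres_cong A R"
    using w by (intro pres_cong.cancel)
  then show ?case using Cons.IH[OF w(1)] l by (simp) (metis pres_cong.trans)
qed

lemma group_presented_group: "group (presented_group A R)"
proof (rule groupI, goal_cases)
  case (1 x y)
  then show ?case by (auto simp: carrier_presented_group mult_presented_group)
next
  case 2
  then show ?case by (auto simp: carrier_presented_group one_presented_group)
next
  case (3 x y z)
  then show ?case by (auto simp: carrier_presented_group mult_presented_group)
next
  case (4 x)
  then show ?case by (auto simp: carrier_presented_group one_presented_group mult_presented_group)
next
  case (5 x)
  then obtain w where w: "w \<in> words A" "x = pres_cong A R `` {w}"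
    by (auto simp: carrier_presented_group)
  have m: "map (apsnd Not) (rev w) \<in> words A" using w by simp
  have "pres_cong A R `` {map (apsnd Not) (rev w)} \<otimes>\<^bsub>presented_group A R\<^esub> x = \<one>\<^bsub>presented_group A R\<^esub>"
    using w m pres_cong_inverse[OF w(1), of R]
    by (simp add: mult_presented_group one_presented_group pres_cong_class_eq_iff)
  then show ?case using m by (auto simp: carrier_presented_group)
qed


section \<open>Coxeter matrices and virtual Artin groups\<close>

text \<open>
  A Coxeter graph with vertex set \<open>S\<close> is given by its Coxeter matrix: distinct \<open>s, t\<close> are joined
  by an edge iff \<open>M s t \<ge> 3\<close>, labelled by \<open>M s t\<close> if \<open>M s t \<ge> 4\<close>. Only the values of \<open>M\<close> on
  \<open>S \<times> S\<close> matter.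
\<close>

definition coxeter_matrix :: "'s set \<Rightarrow> ('s \<Rightarrow> 's \<Rightarrow> enat) \<Rightarrow> bool" where
  "coxeter_matrix S M \<longleftrightarrow>
    (\<forall>s\<in>S. M s s = 1) \<and> (\<forall>s\<in>S. \<forall>t\<in>S. s \<noteq> t \<longrightarrow> M s t = M t s \<and> M s t \<ge> 2)"

fun alternating :: "'a \<Rightarrow> 'a \<Rightarrow> nat \<Rightarrow> 'a list" where
  "alternating a b 0 = []"
| "alternating a b (Suc n) = a # alternating b a n"

datatype 's va_gen = Sigma_gen 's | Tau_gen 's

abbreviation sigma_letter :: "'s \<Rightarrow> 's va_gen \<times> bool" where
  "sigma_letter s \<equiv> (Sigma_gen s, True)"

abbreviation tau_letter :: "'s \<Rightarrow> 's va_gen \<times> bool" where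
  "tau_letter s \<equiv> (Tau_gen s, True)"

definition va_gens :: "'s set \<Rightarrow> 's va_gen set" where
  "va_gens S = Sigma_gen ` S \<union> Tau_gen ` S"

inductive_set va_rels ::
    "'s set \<Rightarrow> ('s \<Rightarrow> 's \<Rightarrow> enat) \<Rightarrow> (('s va_gen \<times> bool) list \<times> ('s va_gen \<times> bool) list) set"
  for S :: "'s set" and M :: "'s \<Rightarrow> 's \<Rightarrow> enat" where
  v1: "s \<in> S \<Longrightarrow> t \<in> S \<Longrightarrow> s \<noteq> t \<Longrightarrow> M s t = enat m \<Longrightarrow>
    (alternating (sigma_letter s) (sigma_letter t) m,
     alternating (sigma_letter t) (sigma_letter s) m) \<in> va_rels S M"
| v2_square: "s \<in> S \<Longrightarrow> ([tau_letter s, tau_letter s], []) \<in> va_rels S M"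
| v2_braid: "s \<in> S \<Longrightarrow> t \<in> S \<Longrightarrow> s \<noteq> t \<Longrightarrow> M s t = enat m \<Longrightarrow>
    (alternating (tau_letter s) (tau_letter t) m,
     alternating (tau_letter t) (tau_letter s) m) \<in> va_rels S M"
| v3: "s \<in> S \<Longrightarrow> t \<in> S \<Longrightarrow> s \<noteq> t \<Longrightarrow> M s t = enat m \<Longrightarrow>
    (sigma_letter s # alternating (tau_letter t) (tau_letter s) (m - 1),
     alternating (tau_letter t) (tau_letter s) (m - 1) @ [sigma_letter (if even m then s else t)])
       \<in> va_rels S M"

definition VA :: "'s set \<Rightarrow> ('s \<Rightarrow> 's \<Rightarrow> enat) \<Rightarrow> ('s va_gen \<times> bool) list set monoid" where
  "VA S M = presented_group (va_gens S) (va_rels S M)"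

definition va_elt ::
    "'s set \<Rightarrow> ('s \<Rightarrow> 's \<Rightarrow> enat) \<Rightarrow> 's va_gen \<Rightarrow> ('s va_gen \<times> bool) list set" where
  "va_elt S M g = pres_cong (va_gens S) (va_rels S M) `` {[(g, True)]}"

text \<open>The elements \<open>\<sigma>\<^sub>x\<close> and \<open>\<tau>\<^sub>x\<close> of \<open>VA S M\<close> with \<open>x \<in> X\<close>.\<close>

definition va_generators ::
    "'s set \<Rightarrow> ('s \<Rightarrow> 's \<Rightarrow> enat) \<Rightarrow> 's set \<Rightarrow> ('s va_gen \<times> bool) list set set" where
  "va_generators S M X = va_elt S M ` va_gens X"

definition VA_sub ::
    "'s set \<Rightarrow> ('s \<Rightarrow> 's \<Rightarrow> enat) \<Rightarrow> 's set \<Rightarrow> ('s va_gen \<times> bool) list set set" where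
  "VA_sub S M X = generate (VA S M) (va_generators S M X)"

lemma group_VA: "group (VA S M)"
  by (simp add: VA_def group_presented_group)

lemma va_generators_subset: "X \<subseteq> S \<Longrightarrow> va_generators S M X \<subseteq> carrier (VA S M)"
  by (auto simp: va_generators_def va_elt_def VA_def carrier_presented_group va_gens_def)

lemma finite_va_generators: "finite X \<Longrightarrow> finite (va_generators S M X)"
  by (simp add: va_generators_def va_gens_def)

lemma VA_sub_top: "VA_sub S M S = carrier (VA S M)"
proof
  interpret group "VA S M" by (rule group_VA)
  show "VA_sub S M S \<subseteq> carrier (VA S M)"
    unfolding VA_sub_def by (intro generate_incl va_generators_subset) simp
  let ?C = "\<lambda>w. pres_cong (va_gens S) (va_rels S M) `` {w}"
  have neg: "?C [(g, False)] = inv\<^bsub>VA S M\<^esub> va_elt S M g" if "g \<in> va_gens S" for g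
  proof (rule inv_equality[symmetric])
    show "?C [(g, False)] \<otimes>\<^bsub>VA S M\<^esub> va_elt S M g = \<one>\<^bsub>VA S M\<^esub>"
      using that pres_cong.cancel[of g "va_gens S" "[]" "[]" False "va_rels S M"]
      by (simp add: VA_def va_elt_def mult_presented_group one_presented_group pres_cong_class_eq_iff)
  qed (use that in \<open>auto simp: VA_def va_elt_def carrier_presented_group\<close>)
  have "?C w \<in> VA_sub S M S" if "w \<in> words (va_gens S)" for w
    using that
  proof (induction w)
    case Nil
    show ?case
      using generate.one[of "VA S M" "va_generators S M S"]
      by (simp add: VA_sub_def VA_def one_presented_group)
  next
    case (Cons l w)
    obtain g e where l: "l = (g, e)" by (cases l)
    have g: "g \<in> va_gens S" using Cons.prems l by simp
    then have "va_elt S M g \<in> va_generators S M S" by (simp add: va_generators_def)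
    then have "?C [l] \<in> VA_sub S M S"
      using neg[OF g] l generate.incl[of _ "va_generators S M S" "VA S M"]
        generate.inv[of _ "va_generators S M S" "VA S M"]
      by (cases e) (auto simp: VA_sub_def va_elt_def)
    moreover have "?C w \<in> VA_sub S M S" using Cons by simp
    ultimately have "?C [l] \<otimes>\<^bsub>VA S M\<^esub> ?C w \<in> VA_sub S M S"
      unfolding VA_sub_def by (rule generate.eng)
    then show ?case
      using Cons.prems by (simp add: VA_def mult_presented_group)
  qed
  then show "carrier (VA S M) \<subseteq> VA_sub S M S"
    by (auto simp: VA_def carrier_presented_group)
qed

end

(* Let W be the Coxeter group, acting on its geometric representation with simple roots alpha_s, and
   let V_X be the span of the alpha_x with x in X. Read a word from left to right and keep track of
   the image k in W of the prefix rewritten so far under sigma_s -> 1, tau_s -> s; replace a letter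
   sigma_s or its inverse by tau_s unless k(alpha_s) lies in V_X. The result represents an element
   that depends only on the element represented by the input: for the relation (v1) this holds because
   V_X contains all, none, or (up to sign) exactly one of the roots in the plane spanned by
   k(alpha_s), k(alpha_t), and in the last case (v3) applies. Words over X are left unchanged.

   Hence a word w of length n representing an element of VA_X also represents what its rewriting does,
   that is, a product of conjugates k sigma_s^(+-1) k^-1 with k(alpha_s) in V_X and of a remainder in
   W_X, where W is embedded through the tau_s.
   Such a conjugate equals x sigma_y x^-1 with x in W_X no longer than k and y in X. So w has a
   representative over X of length at most 2n^2 + 2n, and testing all words over X up to that length
   with the word problem decides membership and finds such a representative. *)

theory Submission
  imports Defs Complex_Main
begin

section \<open>Recursive functions on coded lists\<close>

text \<open>The rewriting is never executed: deciding whether a root lies in V_X would call for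
  exact arithmetic with the numbers cos(pi/m). It only bounds the length of a representative, and
  the program is a bare search that consults nothing but the word problem. The bound adds up from at
  most n conjugates of at most 2n + 1 letters each and a remainder of at most n letters; it equals
  \<open>4 * triangle n\<close>, a function already at hand from the pairing of numbers. The
  rewriting is no homomorphism, since the fate of a letter depends on what stands before it. Its
  invariance is therefore proved for all subspaces at once, the subspace in force being the preimage
  of V_X under k. The Coxeter group is not built separately. It occurs as tau words modulo the
  congruence of VA, with lengths measured there, and as a group of linear maps. The bridge is the
  classical fact that ascents give positive roots, proved by splitting off a factor from a dihedral
  subgroup. The same splitting shows that k sigma_s k^-1 is a generator whenever k(alpha_s) is a
  simple root: the factor split off then has exactly the length that (v3) requires.\<close>

definition recursive :: "nat \<Rightarrow> (nat list \<Rightarrow> nat) \<Rightarrow> bool" where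
  "recursive k f \<longleftrightarrow> (\<exists>p. \<forall>xs. length xs = k \<longrightarrow> computes p xs (f xs))"

abbreviation recursive1 :: "(nat \<Rightarrow> nat) \<Rightarrow> bool" where
  "recursive1 f \<equiv> recursive 1 (\<lambda>xs. f (xs ! 0))"

abbreviation recursive2 :: "(nat \<Rightarrow> nat \<Rightarrow> nat) \<Rightarrow> bool" where
  "recursive2 f \<equiv> recursive 2 (\<lambda>xs. f (xs ! 0) (xs ! 1))"

abbreviation recursive3 :: "(nat \<Rightarrow> nat \<Rightarrow> nat \<Rightarrow> nat) \<Rightarrow> bool" where
  "recursive3 f \<equiv> recursive 3 (\<lambda>xs. f (xs ! 0) (xs ! 1) (xs ! 2))"

lemma recursive_cong:
  "recursive k f \<Longrightarrow> (\<And>xs. length xs = k \<Longrightarrow> f xs = g xs) \<Longrightarrow> recursive k g"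
  by (auto simp: recursive_def)

lemma recursive_proj: "i < k \<Longrightarrow> recursive k (\<lambda>xs. xs ! i)"
  unfolding recursive_def by (intro exI[of _ "Proj i"]) (auto intro: computes.Proj)

lemma recursive_comp:
  assumes f: "recursive (length gs) f" and gs: "list_all (recursive k) gs"
  shows "recursive k (\<lambda>xs. f (map (\<lambda>g. g xs) gs))"
proof -
  obtain p where p: "\<And>xs. length xs = length gs \<Longrightarrow> computes p xs (f xs)"
    using f by (auto simp: recursive_def)
  have "\<forall>g. \<exists>q. g \<in> set gs \<longrightarrow> (\<forall>xs. length xs = k \<longrightarrow> computes q xs (g xs))"
    using gs by (auto simp: recursive_def list_all_iff)
  then obtain Q where Q: "\<And>g xs. g \<in> set gs \<Longrightarrow> length xs = k \<Longrightarrow> computes (Q g) xs (g xs)"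
    by metis
  have "computes (Comp p (map Q gs)) xs (f (map (\<lambda>g. g xs) gs))" if "length xs = k" for xs
    using that by (intro computes.Comp[of "map (\<lambda>g. g xs) gs"]) (auto intro: p Q)
  then show ?thesis by (auto simp: recursive_def)
qed

lemma recursive_comp1:
  "recursive1 f \<Longrightarrow> recursive k g \<Longrightarrow> recursive k (\<lambda>xs. f (g xs))"
  using recursive_comp[of "[g]" "\<lambda>xs. f (xs ! 0)" k] by simp

lemma recursive_comp2:
  "recursive2 f \<Longrightarrow> recursive k g \<Longrightarrow> recursive k h \<Longrightarrow> recursive k (\<lambda>xs. f (g xs) (h xs))"
  using recursive_comp[of "[g, h]" "\<lambda>xs. f (xs ! 0) (xs ! 1)" k] by (simp add: numeral_2_eq_2)

lemma recursive_comp3: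
  "recursive3 f \<Longrightarrow> recursive k g \<Longrightarrow> recursive k h \<Longrightarrow> recursive k i \<Longrightarrow>
    recursive k (\<lambda>xs. f (g xs) (h xs) (i xs))"
  using recursive_comp[of "[g, h, i]" "\<lambda>xs. f (xs ! 0) (xs ! 1) (xs ! 2)" k]
  by (simp add: numeral_2_eq_2 numeral_3_eq_3)

lemma recursive_Suc: "recursive k f \<Longrightarrow> recursive k (\<lambda>xs. Suc (f xs))"
proof (rule recursive_comp1[of Suc])
  show "recursive1 Suc" unfolding recursive_def
    by (intro exI[of _ Succ]) (auto simp: length_Suc_conv intro: computes.Succ)
qed

lemma recursive_const: "recursive k (\<lambda>xs. n)"
proof (induction n)
  case 0
  show ?case unfolding recursive_def by (intro exI[of _ Zero]) (auto intro: computes.Zero)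
qed (rule recursive_Suc)

lemma recursive_primrec:
  assumes "recursive k f" "recursive (Suc (Suc k)) g"
    and "\<And>ys. length ys = k \<Longrightarrow> F 0 ys = f ys"
    and "\<And>n ys. length ys = k \<Longrightarrow> F (Suc n) ys = g (n # F n ys # ys)"
  shows "recursive (Suc k) (\<lambda>xs. F (hd xs) (tl xs))"
proof -
  obtain p where p: "\<And>xs. length xs = k \<Longrightarrow> computes p xs (f xs)"
    using assms(1) by (auto simp: recursive_def)
  obtain q where q: "\<And>xs. length xs = Suc (Suc k) \<Longrightarrow> computes q xs (g xs)"
    using assms(2) by (auto simp: recursive_def)
  have "computes (PrimRec p q) (n # ys) (F n ys)" if "length ys = k" for n ys
  proof (induction n)
    case 0
    show ?case using p[OF that] assms(3)[OF that] by (auto intro: computes.PrimRec_0)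
  next
    case (Suc n)
    have "computes q (n # F n ys # ys) (F (Suc n) ys)"
      using q[of "n # F n ys # ys"] assms(4)[OF that] that by simp
    with Suc show ?case by (rule computes.PrimRec_Suc)
  qed
  then have "computes (PrimRec p q) xs (F (hd xs) (tl xs))" if "length xs = Suc k" for xs
    using that by (cases xs) auto
  then show ?thesis by (auto simp: recursive_def)
qed

lemma recursive_primrec1:
  assumes "recursive2 g" "\<And>n. F (Suc n) = g n (F n)"
  shows "recursive1 F"
proof -
  have "recursive (Suc 0) (\<lambda>xs. F (hd xs))"
    using recursive_primrec[of 0 "\<lambda>_. F 0" "\<lambda>xs. g (xs ! 0) (xs ! 1)" "\<lambda>n _. F n"]
      assms recursive_const by (simp add: numeral_2_eq_2)
  then show ?thesis by (auto elim!: recursive_cong simp: length_Suc_conv)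
qed

lemma recursive_primrec2:
  assumes "recursive1 f" "recursive3 g" "\<And>y. F 0 y = f y" "\<And>n y. F (Suc n) y = g n (F n y) y"
  shows "recursive2 F"
proof -
  have "recursive (Suc 1) (\<lambda>xs. F (hd xs) (tl xs ! 0))"
  proof (rule recursive_primrec[where F = "\<lambda>n ys. F n (ys ! 0)", OF assms(1)])
    show "recursive (Suc (Suc 1)) (\<lambda>xs. g (xs ! 0) (xs ! 1) (xs ! 2))"
      using assms(2) by (simp add: numeral_3_eq_3)
  qed (simp_all add: assms(3,4) numeral_2_eq_2)
  then show ?thesis by (auto elim!: recursive_cong simp: numeral_2_eq_2 length_Suc_conv)
qed

lemma recursive_mu:
  assumes "recursive2 f" "\<And>y. \<exists>n. f n y = 0"
  shows "recursive1 (\<lambda>y. LEAST n. f n y = 0)"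
proof -
  obtain p where "\<And>xs. length xs = 2 \<Longrightarrow> computes p xs (f (xs ! 0) (xs ! 1))"
    using assms(1) by (auto simp: recursive_def)
  from this[of "[_, _]"] have p: "\<And>n y. computes p [n, y] (f n y)" by simp
  have "computes (Mu p) [y] (LEAST n. f n y = 0)" for y
  proof (rule computes.Mu)
    show "computes p [LEAST n. f n y = 0, y] 0"
      using p[of "LEAST n. f n y = 0" y] LeastI_ex[OF assms(2)[of y]] by simp
    show "\<forall>m<LEAST n. f n y = 0. \<exists>z. computes p [m, y] (Suc z)"
    proof (intro allI impI)
      fix m assume "m < (LEAST n. f n y = 0)"
      then have "f m y \<noteq> 0" by (rule not_less_Least)
      then show "\<exists>z. computes p [m, y] (Suc z)" using p[of m y] by (cases "f m y") auto
    qed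
  qed
  then show ?thesis unfolding recursive_def
    by (intro exI[of _ "Mu p"]) (auto simp: length_Suc_conv)
qed

lemmas recursive_basic = recursive_proj recursive_const recursive_Suc

lemma recursive_if0:
  assumes "recursive k c" "recursive k f" "recursive k g"
  shows "recursive k (\<lambda>xs. if c xs = 0 then f xs else g xs)"
proof -
  define F :: "nat \<Rightarrow> nat list \<Rightarrow> nat" where "F = (\<lambda>n ys. if n = 0 then ys ! 0 else ys ! 1)"
  have "recursive (Suc 2) (\<lambda>xs. F (hd xs) (tl xs))"
    \<comment> \<open>Primitive recursion serves as a case distinction. The step function receives
      the counter, the previous value and the two parameters, so index 3 is the second
      parameter.\<close>
    by (rule recursive_primrec[of 2 "\<lambda>ys. ys ! 0" "\<lambda>xs. xs ! 3"])
      (auto simp: F_def numeral_3_eq_3 numeral_2_eq_2 intro: recursive_proj)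
  then have "recursive3 (\<lambda>n a b. if n = 0 then a else b)"
    by (auto elim!: recursive_cong simp: F_def numeral_2_eq_2 numeral_3_eq_3 length_Suc_conv)
  from recursive_comp3[OF this assms] show ?thesis .
qed

lemma recursive_pred: "recursive k f \<Longrightarrow> recursive k (\<lambda>xs. f xs - 1)"
  by (rule recursive_comp1[of "\<lambda>n. n - 1"], rule recursive_primrec1[of "\<lambda>n _. n"])
    (simp_all add: recursive_basic)

lemma recursive_add:
  assumes "recursive k f" "recursive k g"
  shows "recursive k (\<lambda>xs. f xs + g xs)"
proof (rule recursive_comp2[of "(+)", OF _ assms])
  show "recursive2 (+)"
    by (rule recursive_primrec2[of "\<lambda>y. y" "\<lambda>n z y. Suc z"]) (simp_all add: recursive_basic)
qed

lemma recursive_diff: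
  assumes "recursive k f" "recursive k g"
  shows "recursive k (\<lambda>xs. f xs - g xs)"
proof (rule recursive_comp2[of "\<lambda>n y. y - n", OF _ assms(2,1)])
  show "recursive2 (\<lambda>n y. y - n)"
    by (rule recursive_primrec2[of "\<lambda>y. y" "\<lambda>n z y. z - 1"]) (simp_all add: recursive_basic recursive_pred[simplified])
qed

lemma recursive_triangle: "recursive k f \<Longrightarrow> recursive k (\<lambda>xs. triangle (f xs))"
  by (rule recursive_comp1[of triangle], rule recursive_primrec1[of "\<lambda>n z. z + Suc n"])
    (simp_all add: recursive_basic recursive_add)

lemma recursive_pair:
  "recursive k f \<Longrightarrow> recursive k g \<Longrightarrow> recursive k (\<lambda>xs. prod_encode (f xs, g xs))"
  by (simp add: prod_encode_def recursive_add recursive_triangle)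

section \<open>Inverting the pairing function\<close>

lemma triangle_mono: "m \<le> n \<Longrightarrow> triangle m \<le> triangle n"
  by (induction n) (auto simp: le_Suc_eq)

lemma prod_decode_sum:
  "triangle (fst (prod_decode z) + snd (prod_decode z)) + fst (prod_decode z) = z"
  using prod_decode_inverse[of z] unfolding prod_encode_def by (simp add: case_prod_beta)

text \<open>A number \<open>z\<close> whose components add up to d satisfies triangle d <= z <
  triangle (d + 1). Truncated subtraction turns the second inequality into a zero test, so one
  unbounded search finds d, and both components are then differences of known quantities.\<close>

lemma prod_decode_least:
  "(LEAST s. Suc z - triangle (Suc s) = 0) = fst (prod_decode z) + snd (prod_decode z)"
proof -
  obtain a b where ab: "prod_decode z = (a, b)" by (cases "prod_decode z")
  then have z: "z = triangle (a + b) + a"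
    using prod_decode_sum[of z] by simp
  have "(LEAST s. Suc z - triangle (Suc s) = 0) = a + b"
  proof (rule Least_equality)
    show "a + b \<le> s" if "Suc z - triangle (Suc s) = 0" for s
      using that z triangle_mono[of "Suc s" "a + b"] by (intro leI notI) simp
  qed (simp add: z)
  then show ?thesis by (simp add: ab)
qed

lemma recursive_unpair:
  assumes "recursive k f"
  shows "recursive k (\<lambda>xs. fst (prod_decode (f xs)))" "recursive k (\<lambda>xs. snd (prod_decode (f xs)))"
proof -
  have "recursive1 (\<lambda>z. LEAST s. Suc z - triangle (Suc s) = 0)"
  proof (rule recursive_mu)
    show "recursive2 (\<lambda>n y. Suc y - triangle (Suc n))"
      by (intro recursive_diff recursive_triangle recursive_basic) simp_all
    show "\<exists>n. Suc y - triangle (Suc n) = 0" for y by (rule exI[of _ y]) simp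
  qed
  then have s: "recursive1 (\<lambda>z. fst (prod_decode z) + snd (prod_decode z))"
    unfolding prod_decode_least .
  have a: "fst (prod_decode z) = z - triangle (fst (prod_decode z) + snd (prod_decode z))" for z
    using prod_decode_sum[of z] by linarith
  have *: "recursive1 (\<lambda>z. z - triangle (fst (prod_decode z) + snd (prod_decode z)))"
    by (intro recursive_diff recursive_triangle s recursive_basic) simp
  have fst: "recursive1 (\<lambda>z. fst (prod_decode z))" using * unfolding a[symmetric] .
  then have snd: "recursive1 (\<lambda>z. snd (prod_decode z))"
    using recursive_diff[OF s fst] by simp
  show "recursive k (\<lambda>xs. fst (prod_decode (f xs)))" "recursive k (\<lambda>xs. snd (prod_decode (f xs)))"
    using recursive_comp1[OF fst assms] recursive_comp1[OF snd assms] .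
qed

text \<open>Finite tables are recursive: each value in front of the constant tail costs one
  primitive recursion whose step looks only at the counter.\<close>

lemma recursive_eventually_const:
  assumes "\<And>n. n \<ge> N \<Longrightarrow> f n = c"
  shows "recursive1 f"
  using assms
proof (induction N arbitrary: f)
  case 0
  then have "f = (\<lambda>_. c)" by auto
  then show ?case using recursive_const by simp
next
  case (Suc N)
  have "recursive1 (\<lambda>n. f (Suc n))" by (rule Suc.IH) (use Suc.prems in simp)
  then have "recursive2 (\<lambda>n z. f (Suc n))"
    by (rule recursive_comp1[of "\<lambda>n. f (Suc n)"]) (simp add: recursive_proj)
  then show ?case by (rule recursive_primrec1) simp
qed

section \<open>Reversing and translating coded lists\<close>

definition rev_step :: "(nat \<Rightarrow> nat) \<Rightarrow> nat \<Rightarrow> nat" where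
  "rev_step T z = (if fst (prod_decode z) = 0 then z else
     prod_encode (snd (prod_decode (fst (prod_decode z) - 1)),
       Suc (prod_encode (T (fst (prod_decode (fst (prod_decode z) - 1))), snd (prod_decode z)))))"

text \<open>A pair codes two stacks: each step pops the left one and pushes the translated entry on
  the right one, and an empty left stack is a fixed point. The code \<open>x\<close> of the left
  list is at least its length and so can itself serve as the number of iterations.\<close>

definition rev_onto :: "(nat \<Rightarrow> nat) \<Rightarrow> nat \<Rightarrow> nat \<Rightarrow> nat" where
  "rev_onto T x y = snd (prod_decode ((rev_step T ^^ x) (prod_encode (x, y))))"

lemma length_le_list_encode: "length l \<le> list_encode l"
  by (induction l) (auto intro: le_trans[OF _ le_prod_encode_2])

lemma rev_step_iterate:
  "length l \<le> n \<Longrightarrow> (rev_step T ^^ n) (prod_encode (list_encode l, list_encode r)) =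
    prod_encode (0, list_encode (rev (map T l) @ r))"
proof (induction n arbitrary: l r)
  case (Suc n)
  show ?case
  proof (cases l)
    case Nil
    have "rev_step T (prod_encode (0, list_encode r)) = prod_encode (0, list_encode r)"
      by (simp add: rev_step_def)
    then show ?thesis using Suc.IH[of "[]" r] Nil by (simp add: funpow_swap1)
  next
    case (Cons a l')
    have "rev_step T (prod_encode (list_encode l, list_encode r)) =
        prod_encode (list_encode l', list_encode (T a # r))"
      by (simp add: rev_step_def Cons)
    then show ?thesis using Suc.IH[of l' "T a # r"] Suc.prems Cons
      by (simp add: funpow_swap1 del: list_encode.simps)
  qed
qed simp

lemma rev_onto_code: "rev_onto T (list_encode l) (list_encode r) = list_encode (rev (map T l) @ r)"
  by (simp add: rev_onto_def rev_step_iterate length_le_list_encode)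

lemma recursive_funpow:
  assumes "recursive1 f" "recursive k g" "recursive k h"
  shows "recursive k (\<lambda>xs. (f ^^ g xs) (h xs))"
proof (rule recursive_comp2[of "\<lambda>n x. (f ^^ n) x", OF _ assms(2,3)])
  have "recursive3 (\<lambda>n z y. f z)" by (rule recursive_comp1[OF assms(1)]) (simp add: recursive_proj)
  from recursive_primrec2[OF _ this, of "\<lambda>y. y" "\<lambda>n x. (f ^^ n) x"]
  show "recursive2 (\<lambda>n x. (f ^^ n) x)" by (simp add: recursive_basic)
qed

lemma recursive_rev_onto:
  assumes "recursive1 T" "recursive k f" "recursive k g"
  shows "recursive k (\<lambda>xs. rev_onto T (f xs) (g xs))"
proof -
  have "recursive1 (rev_step T)"
    unfolding rev_step_def
    by (intro recursive_if0 recursive_pair recursive_unpair recursive_Suc recursive_pred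
        recursive_proj recursive_comp1[OF assms(1)]) simp_all
  then show ?thesis unfolding rev_onto_def
    by (intro recursive_unpair recursive_funpow recursive_pair assms)
qed

section \<open>Bounded search through codes of lists\<close>

definition list_code_bound :: "nat \<Rightarrow> nat \<Rightarrow> nat" where
  "list_code_bound b n = ((\<lambda>x. Suc (prod_encode (b, x))) ^^ n) 0"

lemma prod_encode_mono:
  assumes "a \<le> a'" "b \<le> b'" shows "prod_encode (a, b) \<le> prod_encode (a', b')"
  using assms by (auto simp: prod_encode_def intro: add_mono triangle_mono)

text \<open>The pairing function is monotone, so the largest code belongs to the list of
  \<open>n\<close> copies of \<open>b\<close>.\<close>

lemma list_encode_le_bound:
  "length l \<le> n \<Longrightarrow> set l \<subseteq> {..b} \<Longrightarrow> list_encode l \<le> list_code_bound b n"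
proof (induction l arbitrary: n)
  case (Cons x l)
  then obtain n' where n': "n = Suc n'" by (cases n) auto
  then show ?case using Cons prod_encode_mono[of x b] by (auto simp: list_code_bound_def)
qed simp

lemma recursive_list_code_bound:
  "recursive k f \<Longrightarrow> recursive k (\<lambda>xs. list_code_bound b (f xs))"
  unfolding list_code_bound_def
  by (intro recursive_funpow recursive_Suc recursive_pair recursive_basic) simp_all

text \<open>The successor keeps a hit with output 0 apart from failure and agrees with the output
  convention of \<open>strong_membership_solvable\<close>.\<close>

fun search :: "(nat \<Rightarrow> nat \<Rightarrow> nat) \<Rightarrow> (nat \<Rightarrow> nat) \<Rightarrow> nat \<Rightarrow> nat \<Rightarrow> nat" where
  "search q N 0 c = 0"
| "search q N (Suc y) c =
    (if search q N y c = 0 then if q y c = 0 then 0 else Suc (N y) else search q N y c)"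

lemma search_0_iff: "search q N n c = 0 \<longleftrightarrow> (\<forall>y<n. q y c = 0)"
  by (induction n) (auto simp: less_Suc_eq)

lemma search_SucD: "search q N n c = Suc r \<Longrightarrow> \<exists>y. q y c \<noteq> 0 \<and> r = N y"
  by (induction n) (auto split: if_splits)

lemma recursive_search:
  assumes "recursive2 q" "recursive1 N" "recursive k f" "recursive k g"
  shows "recursive k (\<lambda>xs. search q N (f xs) (g xs))"
proof (rule recursive_comp2[of "search q N", OF _ assms(3,4)])
  have "recursive3 (\<lambda>n z y. if z = 0 then if q n y = 0 then 0 else Suc (N n) else z)"
    by (intro recursive_if0 recursive_Suc recursive_comp1[OF assms(2)] recursive_comp2[OF assms(1)]
        recursive_const recursive_proj) simp_all
  from recursive_primrec2[OF _ this, of "\<lambda>y. 0" "search q N"]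
  show "recursive2 (search q N)" by (simp add: recursive_basic)
qed

text \<open>A statement about bare numbers: \<open>P\<close> will be the word problem,
  \<open>T\<close> the passage from a letter of the subgroup to its inverse in the group, and
  \<open>clip\<close> the repair of codes that stand for no letter. Every number up to a bound is
  tried, also those whose lists are too long or have entries out of range. As \<open>clip\<close>
  repairs them, any hit is usable, which is why the successor case carries no bound on
  \<open>l\<close>.\<close>

lemma bounded_list_search:
  assumes "recursive1 P" "recursive1 T" "recursive1 clip"
  shows "\<exists>p. \<forall>c. \<exists>r. computes p [c] r \<and>
    (case r of
       0 \<Rightarrow> \<forall>l. length l \<le> 4 * triangle c \<longrightarrow> set l \<subseteq> {..b} \<longrightarrow>
         P (list_encode (rev (map T (map clip l)) @ list_decode c)) = 0
     | Suc r' \<Rightarrow> \<exists>l. r' = list_encode (map clip l) \<and>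
         P (list_encode (rev (map T (map clip l)) @ list_decode c)) \<noteq> 0)"
proof -
  define N where "N y = rev_onto clip y 0" for y
  define q where "q y c = P (rev_onto T (N y) c)" for y c
  define R where "R c = search q N (Suc (list_code_bound b (4 * triangle c))) c" for c
  \<comment> \<open>\<open>rev_onto\<close> reverses, so a candidate is enumerated by the code of
    its reversal. The second reversal, in \<open>q\<close>, is the one that forms the inverse word
    in front of the input.\<close>
  have N: "N (list_encode (rev l)) = list_encode (map clip l)" for l
    using rev_onto_code[of clip "rev l" "[]"] by (simp add: N_def rev_map)
  have q: "q (list_encode (rev l)) c = P (list_encode (rev (map T (map clip l)) @ list_decode c))" for l c
    using rev_onto_code[of T "map clip l" "list_decode c"] N by (simp add: q_def)
  have rN: "recursive1 N" unfolding N_def by (intro recursive_rev_onto assms recursive_basic) simp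
  have "recursive2 q" unfolding q_def
    by (intro recursive_comp1[OF assms(1)] recursive_rev_onto recursive_comp1[OF rN] assms recursive_basic) simp_all
  then have "recursive1 (\<lambda>c. search q N (Suc (list_code_bound b (triangle c + triangle c + (triangle c + triangle c)))) c)"
    by (intro recursive_search rN recursive_Suc recursive_list_code_bound recursive_add recursive_triangle
        recursive_basic) simp_all
  moreover have "4 * triangle c = triangle c + triangle c + (triangle c + triangle c)" for c by simp
  ultimately have "recursive1 R" by (simp only: R_def)
  then obtain p where "\<And>xs. length xs = 1 \<Longrightarrow> computes p xs (R (xs ! 0))" by (auto simp: recursive_def)
  from this[of "[_]"] have p: "\<And>c. computes p [c] (R c)" by simp
  have "case R c of
       0 \<Rightarrow> \<forall>l. length l \<le> 4 * triangle c \<longrightarrow> set l \<subseteq> {..b} \<longrightarrow>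
         P (list_encode (rev (map T (map clip l)) @ list_decode c)) = 0
     | Suc r' \<Rightarrow> \<exists>l. r' = list_encode (map clip l) \<and>
         P (list_encode (rev (map T (map clip l)) @ list_decode c)) \<noteq> 0" for c
  proof (cases "R c")
    case 0
    have "P (list_encode (rev (map T (map clip l)) @ list_decode c)) = 0"
      if "length l \<le> 4 * triangle c" "set l \<subseteq> {..b}" for l
      using 0 list_encode_le_bound[of "rev l" "4 * triangle c" b] that
      unfolding R_def search_0_iff by (metis length_rev less_Suc_eq_le q set_rev)
    then show ?thesis using 0 by simp
  next
    case (Suc r')
    then obtain y where y: "q y c \<noteq> 0" "r' = N y" using search_SucD unfolding R_def by blast
    define l where "l = rev (list_decode y)"
    have yl: "y = list_encode (rev l)" by (simp add: l_def)
    have "r' = list_encode (map clip l)" "P (list_encode (rev (map T (map clip l)) @ list_decode c)) \<noteq> 0"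
      using y N[of l] q[of l c] unfolding yl by simp_all
    then show ?thesis using Suc by auto
  qed
  with p show ?thesis by blast
qed

section \<open>Coded words, and membership from a length bound\<close>

lemma words_image_iff: "w \<in> words (f ` A) \<longleftrightarrow> (\<exists>u\<in>words A. w = map (apfst f) u)"
proof
  assume "w \<in> words (f ` A)"
  then show "\<exists>u\<in>words A. w = map (apfst f) u"
  proof (induction w)
    case (Cons l w)
    then obtain u where "u \<in> words A" "w = map (apfst f) u" by auto
    moreover obtain a where "a \<in> A" "fst l = f a" using Cons.prems by auto
    ultimately show ?case by (intro bexI[of _ "(a, snd l) # u"]) (auto simp: prod_eq_iff)
  qed simp
next
  assume "\<exists>u\<in>words A. w = map (apfst f) u"
  then obtain u where "u \<in> words A" "w = map (apfst f) u" by blast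
  then show "w \<in> words (f ` A)" by (induction u arbitrary: w) auto
qed

lemma four_triangle: "4 * triangle n = 2 * (n * n) + 2 * n"
  by (induction n) auto

definition letter_code :: "'a set \<Rightarrow> 'a \<times> bool \<Rightarrow> nat" where
  "letter_code A = (\<lambda>(a, e). 2 * to_nat_on A a + of_bool e)"

definition code_letter :: "'a set \<Rightarrow> nat \<Rightarrow> 'a \<times> bool" where
  "code_letter A n = (from_nat_into A (n div 2), odd n)"

definition clip_code :: "'a set \<Rightarrow> nat \<Rightarrow> nat" where
  "clip_code A n = (if n < 2 * card A then n else 0)"

lemma word_code_eq: "word_code A w = list_encode (map (letter_code A) w)"
  by (simp add: word_code_def letter_code_def)

lemma letter_code_less:
  assumes "finite A" "fst l \<in> A"
  shows "letter_code A l < 2 * card A"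
proof -
  have "to_nat_on A (fst l) < card A"
    using to_nat_on_finite[OF assms(1)] assms(2) by (auto simp: bij_betw_def)
  then show ?thesis by (cases l) (auto simp: letter_code_def)
qed

lemma code_letter_code: "finite A \<Longrightarrow> fst l \<in> A \<Longrightarrow> code_letter A (letter_code A l) = l"
  by (cases l) (auto simp: code_letter_def letter_code_def countable_finite)

lemma letter_code_letter:
  assumes "finite A" "n < 2 * card A"
  shows "letter_code A (code_letter A n) = n"
proof -
  have "to_nat_on A (from_nat_into A (n div 2)) = n div 2"
    using assms to_nat_on_finite[OF assms(1)]
    by (intro to_nat_on_from_nat_into) (auto simp: bij_betw_def)
  then show ?thesis by (simp add: letter_code_def code_letter_def)
qed

lemma clip_letter_code: "finite A \<Longrightarrow> fst l \<in> A \<Longrightarrow> clip_code A (letter_code A l) = letter_code A l"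
  by (simp add: clip_code_def letter_code_less)

lemma map_clip_letter_code:
  "finite A \<Longrightarrow> w \<in> words A \<Longrightarrow> map (clip_code A) (map (letter_code A) w) = map (letter_code A) w"
  by (induction w) (auto simp: clip_letter_code)

lemma map_code_letter_code:
  "finite A \<Longrightarrow> w \<in> words A \<Longrightarrow> map (code_letter A) (map (letter_code A) w) = w"
  by (induction w) (auto simp: code_letter_code)

lemma code_letter_words: "A \<noteq> {} \<Longrightarrow> map (code_letter A) l \<in> words A"
  by (induction l) (auto simp: code_letter_def from_nat_into)

lemma map_letter_code_clip:
  assumes "finite A" "A \<noteq> {}"
  shows "map (letter_code A) (map (code_letter A) (map (clip_code A) l)) = map (clip_code A) l"
proof -
  have "clip_code A n < 2 * card A" for n using assms by (auto simp: clip_code_def card_gt_0_iff)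
  then show ?thesis using letter_code_letter[OF assms(1)] by simp
qed

lemma recursive_clip_code: "recursive1 (clip_code A)"
  by (rule recursive_eventually_const[of "2 * card A" _ 0]) (simp add: clip_code_def)

text \<open>The given program is specified on codes of words only and may diverge elsewhere.
  Clipping all entries beforehand makes it total; two reversals preserve the order of the
  letters.\<close>

lemma word_problem_recursive:
  assumes "finite A" "A \<noteq> {}" "word_problem_solvable G A"
  obtains P where "recursive1 P"
    "\<And>w. w \<in> words A \<Longrightarrow> P (list_encode (map (letter_code A) w)) = of_bool (word_val G w = \<one>\<^bsub>G\<^esub>)"
proof -
  obtain p where p: "\<And>w. w \<in> words A \<Longrightarrow> computes p [word_code A w] (of_bool (word_val G w = \<one>\<^bsub>G\<^esub>))"
    using assms(3) unfolding word_problem_solvable_def of_bool_def by blast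
  define san where "san n = rev_onto (\<lambda>x. x) (rev_onto (clip_code A) n 0) 0" for n
  have san: "san (list_encode l) = list_encode (map (clip_code A) l)" for l
    using rev_onto_code[of "clip_code A" l "[]"] rev_onto_code[of "\<lambda>x. x" "rev (map (clip_code A) l)" "[]"]
    by (simp add: san_def)
  have "recursive1 san" unfolding san_def
    by (intro recursive_rev_onto recursive_clip_code recursive_basic) simp_all
  then obtain s where "\<And>xs. length xs = 1 \<Longrightarrow> computes s xs (san (xs ! 0))"
    by (auto simp: recursive_def)
  from this[of "[_]"] have s: "\<And>n. computes s [n] (san n)" by simp
  define W where "W n = map (code_letter A) (map (clip_code A) (list_decode n))" for n
  define P :: "nat \<Rightarrow> nat" where "P n = of_bool (word_val G (W n) = \<one>\<^bsub>G\<^esub>)" for n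
  have "word_code A (W n) = san n" for n
    using san[of "list_decode n"] map_letter_code_clip[OF assms(1,2), of "list_decode n"]
    by (simp add: W_def word_code_eq del: map_map)
  moreover have "W n \<in> words A" for n unfolding W_def using code_letter_words[OF assms(2)] .
  ultimately have "computes p [san n] (P n)" for n using p[of "W n"] by (simp add: P_def)
  then have "computes (Comp p [s]) [n] (P n)" for n
    using s by (intro computes.Comp[of "[san n]"]) auto
  then have "recursive1 P" unfolding recursive_def by (intro exI[of _ "Comp p [s]"]) (auto simp: length_Suc_conv)
  moreover have "P (list_encode (map (letter_code A) w)) = of_bool (word_val G w = \<one>\<^bsub>G\<^esub>)"
    if "w \<in> words A" for w
    using map_clip_letter_code[OF assms(1) that] map_code_letter_code[OF assms(1) that]
    by (simp add: P_def W_def del: map_map)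
  ultimately show ?thesis using that by blast
qed

text \<open>A candidate v is tested by applying the word problem to v^-1 w. The length bound turns
  the failure of a finite search into a proof of non-membership.\<close>

lemma strong_membership_of_bound:
  assumes A: "finite A" "A \<noteq> {}" and B: "B \<subseteq> A" "B \<noteq> {}" and wp: "word_problem_solvable G A"
    and inverse: "\<And>w v. w \<in> words A \<Longrightarrow> v \<in> words A \<Longrightarrow>
      word_val G (map (apsnd Not) (rev v) @ w) = \<one>\<^bsub>G\<^esub> \<longleftrightarrow> word_val G v = word_val G w"
    and subgroup: "\<And>v. v \<in> words B \<Longrightarrow> word_val G v \<in> H"
    and bound: "\<And>w. w \<in> words A \<Longrightarrow> word_val G w \<in> H \<Longrightarrow>
      \<exists>v\<in>words B. word_val G v = word_val G w \<and> length v \<le> 4 * triangle (length w)"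
  shows "strong_membership_solvable G A H B"
proof -
  have fB: "finite B" using A B finite_subset by blast
  have BA: "v \<in> words A" if "v \<in> words B" for v using that B(1) by (auto simp: words_def)
  obtain P where P: "recursive1 P"
    "\<And>w. w \<in> words A \<Longrightarrow> P (list_encode (map (letter_code A) w)) = of_bool (word_val G w = \<one>\<^bsub>G\<^esub>)"
    using word_problem_recursive[OF A wp] by blast
  \<comment> \<open>The two alphabets are numbered independently, so codes have to be translated.
    Clipped entries never reach the default 0; it only makes the table eventually constant.\<close>
  define T where "T n = (if n < 2 * card B then letter_code A (apsnd Not (code_letter B n)) else 0)" for n
  have rT: "recursive1 T" by (rule recursive_eventually_const[of "2 * card B" _ 0]) (simp add: T_def)
  have T: "map T (map (letter_code B) v) = map (letter_code A) (map (apsnd Not) v)" if "v \<in> words B" for v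
    using that by (induction v) (auto simp: T_def letter_code_less[OF fB] code_letter_code[OF fB])
  obtain p where p: "\<And>c. \<exists>r. computes p [c] r \<and>
    (case r of
       0 \<Rightarrow> \<forall>l. length l \<le> 4 * triangle c \<longrightarrow> set l \<subseteq> {..2 * card B} \<longrightarrow>
         P (list_encode (rev (map T (map (clip_code B) l)) @ list_decode c)) = 0
     | Suc r' \<Rightarrow> \<exists>l. r' = list_encode (map (clip_code B) l) \<and>
         P (list_encode (rev (map T (map (clip_code B) l)) @ list_decode c)) \<noteq> 0)"
    using bounded_list_search[OF P(1) rT recursive_clip_code[of B], of "2 * card B"] by blast
  have test: "P (list_encode (rev (map T (map (letter_code B) v)) @ list_decode (word_code A w))) \<noteq> 0
      \<longleftrightarrow> word_val G v = word_val G w" if v: "v \<in> words B" and w: "w \<in> words A" for v w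
  proof -
    have eq: "rev (map T (map (letter_code B) v)) @ list_decode (word_code A w) =
        map (letter_code A) (map (apsnd Not) (rev v) @ w)"
      unfolding T[OF v] by (simp add: word_code_eq rev_map)
    have "map (apsnd Not) (rev v) @ w \<in> words A" using BA[OF v] w by simp
    from P(2)[OF this] inverse[OF w BA[OF v]] show ?thesis unfolding eq by simp
  qed
  have "(word_val G w \<in> H \<longrightarrow>
        (\<exists>v \<in> words B. word_val G v = word_val G w \<and>
          computes p [word_code A w] (Suc (word_code B v)))) \<and>
      (word_val G w \<notin> H \<longrightarrow> computes p [word_code A w] 0)" if w: "w \<in> words A" for w
  proof -
    let ?c = "word_code A w"
    obtain r where r: "computes p [?c] r" and spec: "case r of
       0 \<Rightarrow> \<forall>l. length l \<le> 4 * triangle ?c \<longrightarrow> set l \<subseteq> {..2 * card B} \<longrightarrow>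
         P (list_encode (rev (map T (map (clip_code B) l)) @ list_decode ?c)) = 0
     | Suc r' \<Rightarrow> \<exists>l. r' = list_encode (map (clip_code B) l) \<and>
         P (list_encode (rev (map T (map (clip_code B) l)) @ list_decode ?c)) \<noteq> 0"
      using p by blast
    show ?thesis
    proof (cases r)
      case 0
      have "word_val G w \<notin> H"
      proof
        assume "word_val G w \<in> H"
        then obtain v where v: "v \<in> words B" "word_val G v = word_val G w" "length v \<le> 4 * triangle (length w)"
          using bound w by blast
        let ?l = "map (letter_code B) v"
        \<comment> \<open>The search is bounded in terms of the code of \<open>w\<close>, which is
          at least the length; this spares the program the computation of the length.\<close>
        have "length w \<le> ?c" using length_le_list_encode[of "map (letter_code A) w"] by (simp add: word_code_eq)
        then have l_len: "length ?l \<le> 4 * triangle ?c" using v(3) triangle_mono[of "length w" ?c] by simp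
        have "fst l \<in> B" if "l \<in> set v" for l
          using v(1) that by (auto simp: words_def in_lists_conv_set)
        then have "set ?l \<subseteq> {..2 * card B}" using letter_code_less[OF fB] less_imp_le by fastforce
        with l_len have "P (list_encode (rev (map T (map (clip_code B) ?l)) @ list_decode ?c)) = 0"
          using spec unfolding 0 nat.case by blast
        then show False
          using test[OF v(1) w] v(2) unfolding map_clip_letter_code[OF fB v(1)] by blast
      qed
      then show ?thesis using r 0 by simp
    next
      case (Suc r')
      then obtain l where l: "r' = list_encode (map (clip_code B) l)"
        "P (list_encode (rev (map T (map (clip_code B) l)) @ list_decode ?c)) \<noteq> 0"
        using spec by auto
      define v where "v = map (code_letter B) (map (clip_code B) l)"
      have v: "v \<in> words B" unfolding v_def using code_letter_words[OF B(2)] .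
      have lv: "map (clip_code B) l = map (letter_code B) v"
        unfolding v_def by (rule map_letter_code_clip[OF fB B(2), symmetric])
      have "word_val G v = word_val G w" using test[OF v w] l(2) unfolding lv by blast
      moreover have "r = Suc (word_code B v)" using Suc l(1) unfolding lv by (simp add: word_code_eq)
      ultimately show ?thesis using r v subgroup[OF v] by auto
    qed
  qed
  then show ?thesis unfolding strong_membership_solvable_def by blast
qed

section \<open>The geometric representation\<close>

lemma alternating_snoc:
  "alternating a b (Suc n) = alternating a b n @ [if even n then a else b]"
  by (induction n arbitrary: a b) auto

lemma length_alternating [simp]: "length (alternating a b n) = n"
  by (induction n arbitrary: a b) auto

lemma map_alternating: "map f (alternating a b n) = alternating (f a) (f b) n"
  by (induction n arbitrary: a b) auto

lemma set_alternating: "set (alternating a b n) \<subseteq> {a, b}"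
  by (induction n arbitrary: a b) auto

lemma words_alternating [simp]:
  "fst x \<in> A \<Longrightarrow> fst y \<in> A \<Longrightarrow> alternating x y n \<in> words A"
  by (induction n arbitrary: x y) auto

section \<open>The root space, its subspaces and rank two roots\<close>

definition sroot :: "'s \<Rightarrow> 's \<Rightarrow> real" where
  "sroot s = (\<lambda>i. of_bool (i = s))"

definition linfun :: "(('s \<Rightarrow> real) \<Rightarrow> 's \<Rightarrow> real) \<Rightarrow> bool" where
  "linfun f \<longleftrightarrow> (\<forall>a b v w. f (\<lambda>i. a * v i + b * w i) = (\<lambda>i. a * f v i + b * f w i))"

definition linsub :: "('s \<Rightarrow> real) set \<Rightarrow> bool" where
  "linsub K \<longleftrightarrow> (\<forall>a b. \<forall>v\<in>K. \<forall>w\<in>K. (\<lambda>i. a * v i + b * w i) \<in> K)"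

definition supported :: "'s set \<Rightarrow> ('s \<Rightarrow> real) set" where
  "supported X = {v. \<forall>i. i \<notin> X \<longrightarrow> v i = 0}"

lemma linsub_supported: "linsub (supported X)"
  by (auto simp: linsub_def supported_def)

lemma linfun_comb: "linfun f \<Longrightarrow> f (\<lambda>i. a * v i + b * w i) = (\<lambda>i. a * f v i + b * f w i)"
  by (simp add: linfun_def)

lemma linfun_scale: "linfun f \<Longrightarrow> f (\<lambda>i. a * v i) = (\<lambda>i. a * f v i)"
  using linfun_comb[of f a v 0 v] by simp

lemma linsub_comb: "linsub K \<Longrightarrow> v \<in> K \<Longrightarrow> w \<in> K \<Longrightarrow> (\<lambda>i. a * v i + b * w i) \<in> K"
  by (simp add: linsub_def)

lemma linsub_scale: "linsub K \<Longrightarrow> v \<in> K \<Longrightarrow> (\<lambda>i. a * v i) \<in> K"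
  using linsub_comb[of K v v a 0] by simp

lemma linfun_supported_sum:
  assumes "linfun f" "finite Y" "v \<in> supported Y"
  shows "f v i = (\<Sum>x\<in>Y. v x * f (sroot x) i)"
  using assms(2,3)
proof (induction Y arbitrary: v)
  case empty
  then have "v = (\<lambda>i. 0 * v i)" by (auto simp: supported_def)
  then show ?case using linfun_scale[OF assms(1), of 0 v] by simp
next
  case (insert y Y)
  define w where "w = v(y := 0)"
  have w: "w \<in> supported Y" using insert.prems by (auto simp: supported_def w_def)
  have "v = (\<lambda>i. 1 * w i + v y * sroot y i)"
    by (auto simp: w_def sroot_def)
  then have "f v i = f w i + v y * f (sroot y) i"
    using linfun_comb[OF assms(1), of 1 w "v y" "sroot y"] by simp
  moreover have "(\<Sum>x\<in>Y. w x * f (sroot x) i) = (\<Sum>x\<in>Y. v x * f (sroot x) i)"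
    using insert.hyps by (intro sum.cong) (auto simp: w_def)
  ultimately show ?case using insert.IH[OF w] insert.hyps by simp
qed

text \<open>For \<open>m = enat k\<close> these are the Chebyshev numbers \<open>sin (n\<pi>/k) / sin (\<pi>/k)\<close>; the value at
  \<open>\<infinity>\<close> is their limit.\<close>

definition cheb :: "enat \<Rightarrow> nat \<Rightarrow> real" where
  "cheb m n = (case m of enat k \<Rightarrow> sin (real n * (pi / real k)) / sin (pi / real k) | \<infinity> \<Rightarrow> real n)"

definition coxform :: "enat \<Rightarrow> real" where
  "coxform m = (case m of enat k \<Rightarrow> - cos (pi / real k) | \<infinity> \<Rightarrow> -1)"

lemma sin_pi_div_pos: "k \<ge> 2 \<Longrightarrow> sin (pi / real k) > 0"
  by (intro sin_gt_zero) (auto simp: field_simps)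

lemma cheb_0 [simp]: "cheb m 0 = 0"
  by (simp add: cheb_def split: enat.split)

lemma cheb_1 [simp]: "m \<ge> 2 \<Longrightarrow> cheb m (Suc 0) = 1"
  using sin_pi_div_pos by (force simp: cheb_def numeral_eq_enat split: enat.splits)

lemma cheb_rec: "cheb m (Suc (Suc n)) = - 2 * coxform m * cheb m (Suc n) - cheb m n"
proof (cases m)
  case (enat k)
  define x where "x = pi / real k"
  have "sin (real (Suc (Suc n)) * x) + sin (real n * x) = 2 * cos x * sin (real (Suc n) * x)"
  proof -
    have 1: "real (Suc (Suc n)) * x = real (Suc n) * x + x" "real n * x = real (Suc n) * x - x"
      by (simp_all add: algebra_simps)
    show ?thesis unfolding 1 sin_add sin_diff by simp
  qed
  then show ?thesis
    by (simp add: cheb_def coxform_def enat x_def add_divide_distrib[symmetric] diff_divide_distrib[symmetric] field_simps)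
qed (simp add: cheb_def coxform_def)

lemma cheb_pos:
  assumes "m \<ge> 2" "0 < n" "enat n < m"
  shows "cheb m n > 0"
proof (cases m)
  case (enat k)
  have k: "k \<ge> 2" "n < k" using assms enat by (auto simp: numeral_eq_enat)
  have "real n * pi / real k < pi" using k by (simp add: field_simps)
  then have "sin (real n * (pi / real k)) > 0"
    using assms k by (intro sin_gt_zero) auto
  then show ?thesis using sin_pi_div_pos[OF k(1)] enat by (simp add: cheb_def)
qed (use assms in \<open>simp add: cheb_def\<close>)

lemma cheb_reflect:
  assumes "k \<ge> 2" "i \<le> k"
  shows "cheb (enat k) (k - i) = cheb (enat k) i"
proof -
  have "real (k - i) * (pi / real k) = pi - real i * (pi / real k)"
    using assms by (simp add: of_nat_diff field_simps)
  then show ?thesis by (simp add: cheb_def)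
qed

lemma cheb_top [simp]: "k \<ge> 2 \<Longrightarrow> cheb (enat k) k = 0"
  using cheb_reflect[of k 0] by simp

lemma cheb_pred_top [simp]: "k \<ge> 2 \<Longrightarrow> cheb (enat k) (k - Suc 0) = 1"
  using cheb_reflect[of k 1] by (simp add: numeral_eq_enat)

lemma cheb_Suc_top [simp]:
  assumes "k \<ge> 2" shows "cheb (enat k) (Suc k) = -1"
proof -
  obtain j where j: "k = Suc j" using assms by (cases k) auto
  show ?thesis using cheb_rec[of "enat k" j] assms cheb_top[OF assms] cheb_pred_top[OF assms]
    by (simp add: j)
qed

text \<open>A determinant of two pairs of consecutive values. The recursion multiplies both pairs by
  one matrix of determinant 1, so \<open>i\<close> can be lowered to 0.\<close>

lemma cheb_det:
  "m \<ge> 2 \<Longrightarrow> cheb m (Suc i) * cheb m (i + n) - cheb m i * cheb m (Suc (i + n)) = cheb m n"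
proof (induction i)
  case (Suc i)
  have "cheb m (Suc (Suc i)) * cheb m (Suc i + n) - cheb m (Suc i) * cheb m (Suc (Suc i + n))
      = cheb m (Suc i) * cheb m (i + n) - cheb m i * cheb m (Suc (i + n))"
    by (simp add: cheb_rec algebra_simps)
  then show ?case using Suc by simp
qed simp

text \<open>The roots in the plane of \<open>a\<close> and \<open>b\<close> as the dihedral group
  produces them: if \<open>m\<close> is \<open>M a b\<close>, index \<open>i\<close> is the image of
  a simple root under the alternating product of \<open>i\<close> reflections that begins with
  \<open>a\<close> (\<open>rep_alternating_sroot\<close>). For \<open>m = enat k\<close> the indices
  below \<open>k\<close> give the positive roots.\<close>

definition beta :: "enat \<Rightarrow> 's \<Rightarrow> 's \<Rightarrow> nat \<Rightarrow> 's \<Rightarrow> real" where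
  "beta m a b i = (\<lambda>j. cheb m (Suc i) * sroot a j + cheb m i * sroot b j)"

lemma beta_0 [simp]: "m \<ge> 2 \<Longrightarrow> beta m a b 0 = sroot a"
  by (simp add: beta_def)

text \<open>Starting from the other simple root enumerates the same roots backwards.\<close>

lemma beta_swap:
  assumes "k \<ge> 2" "i < k"
  shows "beta (enat k) b a (k - Suc i) = beta (enat k) a b i"
proof -
  have 1: "Suc (k - Suc i) = k - i" using assms by simp
  show ?thesis
    using cheb_reflect[OF assms(1), of i] cheb_reflect[OF assms(1), of "Suc i"] assms
    by (simp add: beta_def 1 add.commute)
qed

text \<open>Cramer's rule: by \<open>cheb_det\<close> the coordinates of the two roots have
  determinant \<open>cheb m n\<close>, which is nonzero for \<open>0 < n\<close> and
  \<open>enat n < m\<close>. Hence a subspace contains all, none or exactly one of the positive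
  roots of the plane.\<close>

lemma linsub_two_betas:
  assumes "linsub K" "m \<ge> 2" "beta m a b i \<in> K" "beta m a b (i + n) \<in> K" "cheb m n \<noteq> 0"
  shows "sroot a \<in> K \<and> sroot b \<in> K"
proof -
  define d where "d = cheb m n"
  have d: "d \<noteq> 0" and dd: "cheb m (Suc i) * cheb m (i + n) - cheb m i * cheb m (Suc (i + n)) = d"
    using assms cheb_det[of m i n] by (auto simp: d_def)
  have "sroot a = (\<lambda>j. (cheb m (i + n) / d) * beta m a b i j + (- cheb m i / d) * beta m a b (i + n) j)"
  proof
    fix j
    have "(cheb m (i + n) / d) * beta m a b i j + (- cheb m i / d) * beta m a b (i + n) j
      = (cheb m (Suc i) * cheb m (i + n) - cheb m i * cheb m (Suc (i + n))) / d * sroot a j"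
      unfolding beta_def using d by (simp add: divide_simps) (simp add: algebra_simps)
    then show "sroot a j = (cheb m (i + n) / d) * beta m a b i j + (- cheb m i / d) * beta m a b (i + n) j"
      using dd d by simp
  qed
  moreover have "sroot b = (\<lambda>j. (- cheb m (Suc (i + n)) / d) * beta m a b i j + (cheb m (Suc i) / d) * beta m a b (i + n) j)"
  proof
    fix j
    have "(- cheb m (Suc (i + n)) / d) * beta m a b i j + (cheb m (Suc i) / d) * beta m a b (i + n) j
      = (cheb m (Suc i) * cheb m (i + n) - cheb m i * cheb m (Suc (i + n))) / d * sroot b j"
      unfolding beta_def using d by (simp add: divide_simps) (simp add: algebra_simps)
    then show "sroot b j = (- cheb m (Suc (i + n)) / d) * beta m a b i j + (cheb m (Suc i) / d) * beta m a b (i + n) j"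
      using dd d by simp
  qed
  ultimately show ?thesis using linsub_comb[OF assms(1,3,4)] by metis
qed

lemma linsub_beta_left:
  assumes "linsub K" "m \<ge> 2" "sroot b \<in> K" "beta m a b i \<in> K" "cheb m (Suc i) \<noteq> 0"
  shows "sroot a \<in> K"
proof -
  have "sroot a = (\<lambda>j. (1 / cheb m (Suc i)) * beta m a b i j + (- cheb m i / cheb m (Suc i)) * sroot b j)"
    using assms(5) by (auto simp: beta_def field_simps)
  then show ?thesis using linsub_comb[OF assms(1,4,3)] by metis
qed

text \<open>The outcome of rewriting an alternating sigma word when the subspace contains exactly
  one root of its plane: only the letter at position \<open>j\<close> survives as a sigma. For
  \<open>j = 0\<close> and \<open>j = n\<close> these words have the shape of the two sides of
  (v3).\<close>

definition mixed :: "'s \<Rightarrow> 's \<Rightarrow> nat \<Rightarrow> nat \<Rightarrow> ('s va_gen \<times> bool) list" where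
  "mixed a b n j = map (\<lambda>i. if i = j then sigma_letter (if even i then a else b)
     else tau_letter (if even i then a else b)) [0..<Suc n]"

lemma alternating_conv: "alternating a b n = map (\<lambda>i. if even i then a else b) [0..<n]"
  by (induction n) (simp_all add: alternating_snoc del: alternating.simps(2))

lemma mixed_0: "mixed a b n 0 = sigma_letter a # alternating (tau_letter b) (tau_letter a) n"
  by (auto simp: mixed_def alternating_conv upt_conv_Cons map_Suc_upt[symmetric] simp del: upt_Suc)

lemma mixed_last:
  "mixed a b n n = alternating (tau_letter a) (tau_letter b) n @ [sigma_letter (if even n then a else b)]"
  by (auto simp: mixed_def alternating_conv)

lemma mixed_Suc:
  "mixed a b (Suc n) (Suc j) = tau_letter a # mixed b a n j"
  by (auto simp: mixed_def upt_conv_Cons map_Suc_upt[symmetric] simp del: upt_Suc)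

lemma mixed_snoc:
  "j \<le> n \<Longrightarrow> mixed a b (Suc n) j = mixed a b n j @ [tau_letter (if even n then b else a)]"
  by (auto simp: mixed_def)

text \<open>Exponents are ignored because the maps \<open>f s\<close> will be reflections, hence
  involutions.\<close>

fun proj_act :: "('s \<Rightarrow> 'v \<Rightarrow> 'v) \<Rightarrow> 's va_gen \<times> bool \<Rightarrow> 'v \<Rightarrow> 'v" where
  "proj_act f (Tau_gen s, e) v = f s v"
| "proj_act f (Sigma_gen s, e) v = v"

lemma sigma_tau_in_gens [simp]:
  "Sigma_gen s \<in> va_gens S \<longleftrightarrow> s \<in> S" "Tau_gen s \<in> va_gens S \<longleftrightarrow> s \<in> S"
  by (auto simp: va_gens_def)

lemma rev_alternating: "rev (alternating a b n) = (if even n then alternating b a n else alternating a b n)"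
proof (induction n arbitrary: a b)
  case (Suc n)
  then show ?case by (subst alternating_snoc) (simp_all)
qed simp

lemma alternating_append_ex: "m \<le> n \<Longrightarrow> \<exists>r. alternating a b n = alternating a b m @ r \<and> set r \<subseteq> {a, b}"
proof (induction n)
  case (Suc n)
  show ?case
  proof (cases "m \<le> n")
    case True
    then obtain r where "alternating a b n = alternating a b m @ r" "set r \<subseteq> {a, b}" using Suc by blast
    then have "alternating a b (Suc n) = alternating a b m @ r @ [if even n then a else b]"
      "set (r @ [if even n then a else b]) \<subseteq> {a, b}"
      by (simp_all add: alternating_snoc del: alternating.simps)
    then show ?thesis by blast
  next
    case False
    then have "m = Suc n" using Suc by simp
    then show ?thesis by simp
  qed
qed simp

lemma alternatingI:
  assumes "set e \<subseteq> {a, b}" "e \<noteq> []" "hd e = a" "\<And>p x q. e \<noteq> p @ [x, x] @ q"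
  shows "e = alternating a b (length e)"
  using assms
proof (induction e arbitrary: a b)
  case (Cons x e)
  show ?case
  proof (cases e)
    case (Cons y e')
    have "y \<noteq> x" using Cons.prems(4)[of "[]" x e'] Cons by auto
    then have "hd e = b" using Cons.prems Cons by auto
    moreover have "e \<noteq> p @ [z, z] @ q" for p z q using Cons.prems(4)[of "x # p" z q] by auto
    ultimately have "e = alternating b a (length e)"
      using Cons.prems Cons by (intro Cons.IH) auto
    then show ?thesis using Cons.prems by simp
  qed (use Cons.prems in simp)
qed simp

text \<open>The value is positive below \<open>m\<close> and vanishes at the boundary
  \<open>Suc n = m\<close>, the case on which \<open>conj_simple_root\<close> turns.\<close>

lemma cheb_nonneg: "m \<ge> 2 \<Longrightarrow> enat n < m \<Longrightarrow> cheb m (Suc n) \<ge> 0"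
proof (cases "enat (Suc n) < m")
  case False
  assume "m \<ge> 2" "enat n < m"
  then obtain k where k: "m = enat k" "k \<ge> 2" "k = Suc n"
    using False by (cases m) (auto simp: numeral_eq_enat)
  then show ?thesis using cheb_top[of k] by simp
qed (auto intro: less_imp_le cheb_pos)

definition nonneg :: "('s \<Rightarrow> real) \<Rightarrow> bool" where
  "nonneg v \<longleftrightarrow> (\<forall>i. v i \<ge> 0)"

abbreviation tword :: "'s list \<Rightarrow> ('s va_gen \<times> bool) list" where
  "tword \<equiv> map (\<lambda>s. tau_letter s)"

lemma tword_words [simp]: "tword u \<in> words (va_gens S) \<longleftrightarrow> u \<in> lists S"
  by (induction u) auto

lemma in_lists_rev [simp]: "rev u \<in> lists A \<longleftrightarrow> u \<in> lists A"
  by (simp add: in_lists_conv_set)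

locale coxeter_data =
  fixes S :: "'s set" and M :: "'s \<Rightarrow> 's \<Rightarrow> enat"
  assumes finite_S: "finite S" and cox: "coxeter_matrix S M"
begin

lemma M_sym: "s \<in> S \<Longrightarrow> t \<in> S \<Longrightarrow> M s t = M t s"
  using cox by (metis coxeter_matrix_def)

lemma M_ge2: "s \<in> S \<Longrightarrow> t \<in> S \<Longrightarrow> s \<noteq> t \<Longrightarrow> M s t \<ge> 2"
  using cox by (simp add: coxeter_matrix_def)

lemma M_ge2_nat: "s \<in> S \<Longrightarrow> t \<in> S \<Longrightarrow> s \<noteq> t \<Longrightarrow> M s t = enat m \<Longrightarrow> m \<ge> 2"
  using M_ge2[of s t] by (simp add: numeral_eq_enat)

section \<open>The canonical form and its reflections\<close>

definition pairing :: "'s \<Rightarrow> ('s \<Rightarrow> real) \<Rightarrow> real" where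
  "pairing s v = (\<Sum>t\<in>S. (if s = t then 1 else coxform (M s t)) * v t)"

definition reflect :: "'s \<Rightarrow> ('s \<Rightarrow> real) \<Rightarrow> 's \<Rightarrow> real" where
  "reflect s v = (\<lambda>i. v i + (- 2 * pairing s v) * sroot s i)"

abbreviation rep :: "'s list \<Rightarrow> ('s \<Rightarrow> real) \<Rightarrow> 's \<Rightarrow> real" where
  "rep u \<equiv> foldr reflect u"

lemma pairing_comb: "pairing s (\<lambda>i. a * v i + b * w i) = a * pairing s v + b * pairing s w"
  by (simp add: pairing_def sum.distrib sum_distrib_left algebra_simps)

lemma pairing_sroot: "t \<in> S \<Longrightarrow> pairing s (sroot t) = (if s = t then 1 else coxform (M s t))"
  using finite_S by (simp add: pairing_def sroot_def)

lemma linfun_reflect: "linfun (reflect s)"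
  unfolding linfun_def reflect_def pairing_comb by (auto simp: algebra_simps)

lemma linfun_rep: "linfun (rep u)"
  by (induction u) (use linfun_reflect in \<open>auto simp: linfun_def\<close>)

lemma reflect_sroot_self: "s \<in> S \<Longrightarrow> reflect s (sroot s) = (\<lambda>i. - sroot s i)"
  by (auto simp: reflect_def pairing_sroot)

lemma reflect_sroot:
  "t \<in> S \<Longrightarrow> s \<noteq> t \<Longrightarrow> reflect s (sroot t) = (\<lambda>i. sroot t i + (- 2 * coxform (M s t)) * sroot s i)"
  by (simp add: reflect_def pairing_sroot)

lemma reflect_reflect: "s \<in> S \<Longrightarrow> reflect s (reflect s v) = v"
proof -
  assume s: "s \<in> S"
  have "pairing s (reflect s v) = - pairing s v"
    using pairing_comb[of s 1 v "- 2 * pairing s v" "sroot s"] s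
    by (simp add: reflect_def pairing_sroot)
  then show ?thesis by (simp add: reflect_def)
qed

lemma rep_rev_cancel: "u \<in> lists S \<Longrightarrow> rep (rev u) (rep u v) = v"
  by (induction u arbitrary: v) (auto simp: reflect_reflect)

lemma rep_rev_cancel': "u \<in> lists S \<Longrightarrow> rep u (rep (rev u) v) = v"
  using rep_rev_cancel[of "rev u" v] by (simp add: in_lists_conv_set)

text \<open>A reflection acts on the coefficients by the recursion \<open>cheb_rec\<close>; this is
  why Chebyshev numbers describe the rank two roots.\<close>

lemma reflect_beta:
  assumes "a \<in> S" "b \<in> S" "a \<noteq> b"
  shows "reflect a (beta (M a b) b a i) = beta (M a b) a b (Suc i)"
proof -
  have "reflect a (beta (M a b) b a i) =
      (\<lambda>j. cheb (M a b) (Suc i) * reflect a (sroot b) j + cheb (M a b) i * reflect a (sroot a) j)"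
    unfolding beta_def by (rule linfun_comb[OF linfun_reflect])
  then show ?thesis
    using assms by (simp add: reflect_sroot reflect_sroot_self beta_def cheb_rec algebra_simps)
qed

lemma rep_alternating_sroot:
  assumes "a \<in> S" "b \<in> S" "a \<noteq> b"
  shows "rep (alternating a b n) (sroot (if even n then a else b)) = beta (M a b) a b n"
  using assms
proof (induction n arbitrary: a b)
  case 0
  then show ?case using M_ge2[of a b] by simp
next
  case (Suc n)
  have "M b a = M a b" using Suc.prems M_sym by blast
  moreover have "(if even (Suc n) then a else b) = (if even n then b else a)" by simp
  ultimately have "rep (alternating b a n) (sroot (if even (Suc n) then a else b)) = beta (M a b) b a n"
    using Suc.IH[of b a] Suc.prems by (simp del: even_Suc)
  then show ?case using reflect_beta[OF Suc.prems] by simp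
qed

lemma rep_alternating_other:
  assumes "a \<in> S" "b \<in> S" "a \<noteq> b"
  shows "rep (alternating a b (Suc n)) (sroot (if even n then a else b)) = (\<lambda>i. - beta (M a b) a b n i)"
proof -
  let ?c = "if even n then a else b"
  have "?c \<in> S" using assms by simp
  then have "rep (alternating a b (Suc n)) (sroot ?c) = rep (alternating a b n) (\<lambda>i. (-1) * sroot ?c i)"
    by (simp add: alternating_snoc reflect_sroot_self del: alternating.simps)
  then show ?thesis
    using linfun_scale[OF linfun_rep, of _ "-1"] rep_alternating_sroot[OF assms, of n] by simp
qed

lemma rep_fix: "(\<And>s. s \<in> set u \<Longrightarrow> pairing s v = 0) \<Longrightarrow> rep u v = v"
  by (induction u) (auto simp: reflect_def)

text \<open>Both sides are the longest element of the dihedral group, which sends each simple root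
  to the negative of a simple root. The parity of \<open>m\<close> tells which one.\<close>

lemma rep_braid_sroot:
  assumes "s \<in> S" "t \<in> S" "s \<noteq> t" "M s t = enat m"
  shows "rep (alternating s t m) (sroot s) = rep (alternating t s m) (sroot s)"
proof -
  have m: "m \<ge> 2" using M_ge2_nat assms by blast
  then obtain n where n: "m = Suc n" by (cases m) auto
  have ts: "M t s = enat m" using assms M_sym by metis
  have b0: "beta (enat m) t s m = (\<lambda>i. - sroot t i)" "beta (enat m) s t m = (\<lambda>i. - sroot s i)"
    using m by (simp_all add: beta_def)
  have b1: "beta (enat m) t s n = sroot s" "beta (enat m) s t n = sroot t"
    using m cheb_pred_top[OF m] cheb_top[OF m] by (simp_all add: beta_def n)
  show ?thesis
  proof (cases "even n")
    case True
    have "rep (alternating s t m) (sroot s) = (\<lambda>i. - sroot t i)"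
      using rep_alternating_other[OF assms(1-3), of n] True assms(4) b1 by (simp add: n)
    moreover have "rep (alternating t s m) (sroot s) = (\<lambda>i. - sroot t i)"
      using rep_alternating_sroot[of t s m] True assms ts b0 by (simp add: n)
    ultimately show ?thesis by simp
  next
    case False
    have "rep (alternating s t m) (sroot s) = (\<lambda>i. - sroot s i)"
      using rep_alternating_sroot[of s t m] False assms ts b0 by (simp add: n)
    moreover have "rep (alternating t s m) (sroot s) = (\<lambda>i. - sroot s i)"
      using rep_alternating_other[of t s n] False assms ts b1 by (simp add: n)
    ultimately show ?thesis by simp
  qed
qed

text \<open>The plane spanned by the two simple roots has a complement on which both reflections
  are trivial, so it suffices to compare the two sides on that plane.\<close>

lemma rep_braid:
  assumes "s \<in> S" "t \<in> S" "s \<noteq> t" "M s t = enat m"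
  shows "rep (alternating s t m) v = rep (alternating t s m) v"
proof -
  have m: "m \<ge> 2" using M_ge2_nat assms by blast
  have ts: "M t s = enat m" using assms M_sym by metis
  define f where "f = coxform (enat m)"
  have "sin (pi / real m) ^ 2 > 0" using sin_pi_div_pos[OF m] by simp
  then have f1: "1 - f ^ 2 \<noteq> 0" by (simp add: f_def coxform_def sin_squared_eq)
  define A B where "A = pairing s v" and "B = pairing t v"
  \<comment> \<open>Cramer's rule: with these coefficients the vector \<open>p\<close> of the plane
    has the same pairings with \<open>s\<close> and \<open>t\<close> as \<open>v\<close>. The
    denominator is sin^2 (pi/m).\<close>
  define x y where "x = (A - f * B) / (1 - f ^ 2)" and "y = (B - f * A) / (1 - f ^ 2)"
  have xA: "x + f * y = A" and yB: "f * x + y = B"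
  proof -
    have "x + f * y = ((A - f * B) + f * (B - f * A)) / (1 - f ^ 2)"
      by (simp add: x_def y_def add_divide_distrib)
    also have "(A - f * B) + f * (B - f * A) = A * (1 - f ^ 2)"
      by (simp add: algebra_simps power2_eq_square)
    finally show "x + f * y = A" using f1 by simp
    have "f * x + y = (f * (A - f * B) + (B - f * A)) / (1 - f ^ 2)"
      by (simp add: x_def y_def add_divide_distrib)
    also have "f * (A - f * B) + (B - f * A) = B * (1 - f ^ 2)"
      by (simp add: algebra_simps power2_eq_square)
    finally show "f * x + y = B" using f1 by simp
  qed
  define p where "p = (\<lambda>i. x * sroot s i + y * sroot t i)"
  define q where "q = (\<lambda>i. 1 * v i + (-1) * p i)"
  have v: "v = (\<lambda>i. 1 * q i + 1 * p i)" by (simp add: q_def)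
  have q: "pairing s q = 0" "pairing t q = 0"
    unfolding q_def p_def pairing_comb using assms ts xA yB
    by (simp_all add: pairing_sroot A_def B_def f_def algebra_simps)
  have qf: "rep (alternating s t m) q = q" "rep (alternating t s m) q = q"
    using set_alternating[of s t m] set_alternating[of t s m] q by (auto intro!: rep_fix)
  have pp: "rep (alternating s t m) p = rep (alternating t s m) p"
    unfolding p_def linfun_comb[OF linfun_rep]
    using rep_braid_sroot[OF assms] rep_braid_sroot[of t s m] assms ts by simp
  have "rep u v = (\<lambda>i. 1 * rep u q i + 1 * rep u p i)" for u
    by (subst v) (rule linfun_comb[OF linfun_rep])
  then show ?thesis using qf pp by simp
qed

section \<open>Set retractions of the virtual Artin group\<close>

definition cong :: "('s va_gen \<times> bool) list \<Rightarrow> ('s va_gen \<times> bool) list \<Rightarrow> bool" (infix "\<approx>" 50) where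
  "u \<approx> v \<longleftrightarrow> (u, v) \<in> pres_cong (va_gens S) (va_rels S M)"

lemma cong_refl: "u \<in> words (va_gens S) \<Longrightarrow> u \<approx> u"
  by (simp add: cong_def pres_cong.refl)

lemma cong_sym: "u \<approx> v \<Longrightarrow> v \<approx> u"
  by (simp add: cong_def pres_cong.sym)

lemma cong_trans [trans]: "u \<approx> v \<Longrightarrow> v \<approx> w \<Longrightarrow> u \<approx> w"
  unfolding cong_def by (rule pres_cong.trans)

lemma cong_words: "u \<approx> v \<Longrightarrow> u \<in> words (va_gens S) \<and> v \<in> words (va_gens S)"
  unfolding cong_def by (rule pres_cong_words)

lemma cong_append: "u \<approx> u' \<Longrightarrow> v \<approx> v' \<Longrightarrow> u @ v \<approx> u' @ v'"
  unfolding cong_def by (rule pres_cong_append)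

lemma cong_context:
  assumes "u \<approx> v" "p \<in> words (va_gens S)" "q \<in> words (va_gens S)"
  shows "p @ u @ q \<approx> p @ v @ q"
  using assms by (intro cong_append cong_refl)

lemma va_rels_words: "(u, v) \<in> va_rels S M \<Longrightarrow> u \<in> words (va_gens S) \<and> v \<in> words (va_gens S)"
  by (induction rule: va_rels.induct) auto

lemma cong_va_rels: "(u, v) \<in> va_rels S M \<Longrightarrow> u \<approx> v"
  using pres_cong.rel[of u v "va_rels S M" "va_gens S" "[]" "[]"] va_rels_words[of u v]
  by (simp add: cong_def)

lemma cong_cancel: "g \<in> va_gens S \<Longrightarrow> [(g, e), (g, \<not> e)] \<approx> []"
  using pres_cong.cancel[of g "va_gens S" "[]" "[]" e "va_rels S M"] by (simp add: cong_def)

definition actK :: "('s va_gen \<times> bool) list \<Rightarrow> ('s \<Rightarrow> real) \<Rightarrow> 's \<Rightarrow> real" where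
  "actK w = foldr (proj_act reflect) w"

lemma actK_append: "actK (u @ v) x = actK u (actK v x)"
  by (simp add: actK_def)

lemma actK_Nil [simp]: "actK [] x = x"
  by (simp add: actK_def)

lemma actK_Cons [simp]:
  "actK ((Tau_gen s, e) # w) x = reflect s (actK w x)" "actK ((Sigma_gen s, e) # w) x = actK w x"
  by (simp_all add: actK_def)

lemma actK_alternating_tau: "actK (alternating (tau_letter s) (tau_letter t) n) x = rep (alternating s t n) x"
  by (induction n arbitrary: s t) auto

lemma actK_alternating_sigma: "actK (alternating (sigma_letter s) (sigma_letter t) n) x = x"
  by (induction n arbitrary: s t) auto

lemma actK_va_rels: "(u, v) \<in> va_rels S M \<Longrightarrow> actK u x = actK v x"
  by (induction rule: va_rels.induct)
    (auto simp: actK_alternating_tau actK_alternating_sigma actK_append reflect_reflect intro: rep_braid)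

lemma actK_cong: "u \<approx> v \<Longrightarrow> actK u x = actK v x"
  unfolding cong_def
proof (induction arbitrary: x rule: pres_cong.induct)
  case (cancel a p q e)
  then show ?case by (cases a) (auto simp: actK_append reflect_reflect)
qed (simp_all add: actK_append actK_va_rels)

definition step :: "('s \<Rightarrow> real) set \<Rightarrow> 's \<Rightarrow> ('s \<Rightarrow> real) set" where
  "step K s = {v. reflect s v \<in> K}"

text \<open>\<open>K\<close> is the preimage of the span of the simple roots in \<open>X\<close> under the element of the Coxeter
  group read off the \<open>\<tau>\<close>-letters rewritten so far.\<close>

fun retr :: "('s \<Rightarrow> real) set \<Rightarrow> ('s va_gen \<times> bool) list \<Rightarrow> ('s va_gen \<times> bool) list" where
  "retr K [] = []"
| "retr K ((Tau_gen s, e) # w) = (Tau_gen s, e) # retr (step K s) w"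
| "retr K ((Sigma_gen s, e) # w) =
    (if sroot s \<in> K then (Sigma_gen s, e) # retr K w else (Tau_gen s, e) # retr (step K s) w)"

text \<open>The subspace in force after \<open>w\<close> has been read. The action is that of the
  rewritten word, in which a replaced sigma letter counts as a reflection.\<close>

definition state :: "('s \<Rightarrow> real) set \<Rightarrow> ('s va_gen \<times> bool) list \<Rightarrow> ('s \<Rightarrow> real) set" where
  "state K w = {v. actK (retr K w) v \<in> K}"

lemma state_Cons:
  "state K ((Tau_gen s, e) # w) = state (step K s) w"
  "state K ((Sigma_gen s, e) # w) = (if sroot s \<in> K then state K w else state (step K s) w)"
  by (auto simp: state_def step_def)

lemma state_Nil [simp]: "state K [] = K"
  by (simp add: state_def)

lemma retr_append: "retr K (u @ v) = retr K u @ retr (state K u) v"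
  by (induction K u rule: retr.induct) (auto simp: state_Cons)

lemma retr_words: "w \<in> words (va_gens S) \<Longrightarrow> retr K w \<in> words (va_gens S)"
  by (induction K w rule: retr.induct) auto

lemma linsub_step: "linsub K \<Longrightarrow> linsub (step K s)"
  by (auto simp: linsub_def step_def linfun_comb[OF linfun_reflect])

lemma linsub_state: "linsub K \<Longrightarrow> linsub (state K w)"
  by (induction K w rule: retr.induct) (auto simp: state_Cons linsub_step)

lemma linsub_neg: "linsub K \<Longrightarrow> (\<lambda>i. - v i) \<in> K \<longleftrightarrow> v \<in> K"
  using linsub_scale[of K v "-1"] linsub_scale[of K "\<lambda>i. - v i" "-1"] by auto

text \<open>The reflection negates its own root. Replacing a sigma letter thus does not affect the
  decision about a following letter with the same index, and a letter and its inverse are kept or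
  replaced together.\<close>

lemma sroot_step_self: "linsub K \<Longrightarrow> s \<in> S \<Longrightarrow> sroot s \<in> step K s \<longleftrightarrow> sroot s \<in> K"
  by (simp add: step_def reflect_sroot_self linsub_neg)

text \<open>One replaced letter swaps the roles of \<open>a\<close> and \<open>b\<close> and shifts
  the enumeration by one, so the rewriting of an alternating word can be followed by
  induction.\<close>

lemma beta_step:
  assumes "a \<in> S" "b \<in> S" "a \<noteq> b" "M a b = m"
  shows "beta m b a i \<in> step K a \<longleftrightarrow> beta m a b (Suc i) \<in> K"
  using reflect_beta[OF assms(1-3)] assms(4) by (simp add: step_def)

lemma plane_step:
  assumes "linsub K" "a \<in> S" "b \<in> S" "a \<noteq> b" "sroot a \<in> step K a" "sroot b \<in> step K a"
  shows "sroot a \<in> K \<and> sroot b \<in> K"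
proof -
  have a: "sroot a \<in> K" using assms sroot_step_self by blast
  have "(\<lambda>i. sroot b i + (- 2 * coxform (M a b)) * sroot a i) \<in> K" (is "?v \<in> K")
    using assms reflect_sroot[of b a] by (simp add: step_def)
  then have "(\<lambda>i. 1 * ?v i + (2 * coxform (M a b)) * sroot a i) \<in> K"
    using a linsub_comb[OF assms(1)] by blast
  then show ?thesis using a by simp
qed

lemma retr_tau:
  "retr K (alternating (tau_letter a) (tau_letter b) n @ w) =
    alternating (tau_letter a) (tau_letter b) n @ retr {v. rep (alternating a b n) v \<in> K} w"
  by (induction n arbitrary: a b K) (auto simp: step_def)

lemma retr_alternating_all:
  assumes "sroot a \<in> K" "sroot b \<in> K"
  shows "retr K (alternating (sigma_letter a) (sigma_letter b) n) = alternating (sigma_letter a) (sigma_letter b) n"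
  using assms by (induction n arbitrary: a b) auto

lemma retr_alternating_none:
  assumes "a \<in> S" "b \<in> S" "a \<noteq> b" "M a b = m" "linsub K" "\<And>i. i < n \<Longrightarrow> beta m a b i \<notin> K"
  shows "retr K (alternating (sigma_letter a) (sigma_letter b) n) = alternating (tau_letter a) (tau_letter b) n"
  using assms
proof (induction n arbitrary: a b K)
  case (Suc n)
  have "m \<ge> 2" using Suc.prems M_ge2 by blast
  then have "sroot a \<notin> K" using Suc.prems(6)[of 0] by simp
  moreover have "retr (step K a) (alternating (sigma_letter b) (sigma_letter a) n)
      = alternating (tau_letter b) (tau_letter a) n"
    using Suc.prems beta_step[OF Suc.prems(1-4)]
    by (intro Suc.IH) (auto simp: linsub_step M_sym[of b a])
  ultimately show ?case by simp
qed simp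

text \<open>A root met before position \<open>j\<close> would span the plane together with root
  \<open>j\<close>, so the earlier letters turn into taus. The kept letter leaves the subspace
  unchanged, and the letters after it restart the enumeration from the other simple root; there
  again a second root in the subspace is impossible.\<close>

lemma retr_alternating_one:
  assumes "a \<in> S" "b \<in> S" "a \<noteq> b" "M a b = m" "linsub K" "\<not> (sroot a \<in> K \<and> sroot b \<in> K)"
    and "enat n < m" "j \<le> n" "beta m a b j \<in> K"
  shows "retr K (alternating (sigma_letter a) (sigma_letter b) (Suc n)) = mixed a b n j"
  using assms
proof (induction j arbitrary: a b K n)
  case 0
  have m: "m \<ge> 2" using 0 M_ge2 by blast
  have a: "sroot a \<in> K" using 0 m by simp
  have "retr K (alternating (sigma_letter b) (sigma_letter a) n) = alternating (tau_letter b) (tau_letter a) n"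
  proof (rule retr_alternating_none)
    show "beta m b a i \<notin> K" if "i < n" for i
    proof
      assume "beta m b a i \<in> K"
      moreover have "cheb m (Suc i) > 0"
        using that 0 m by (intro cheb_pos) (auto intro: le_less_trans[of _ "enat n"])
      ultimately show False using linsub_beta_left[of K m a b i] 0 a m by auto
    qed
  qed (use 0 M_sym in auto)
  then show ?case using a by (simp add: mixed_0)
next
  case (Suc j)
  have m: "m \<ge> 2" using Suc.prems M_ge2 by blast
  obtain n' where n: "n = Suc n'" using Suc.prems by (cases n) auto
  have "cheb m (Suc j) > 0"
    using Suc.prems m by (intro cheb_pos) (auto intro: le_less_trans[of _ "enat n"])
  then have a: "sroot a \<notin> K"
    using linsub_two_betas[of K m a b 0 "Suc j"] Suc.prems m by auto
  have "retr (step K a) (alternating (sigma_letter b) (sigma_letter a) (Suc n')) = mixed b a n' j"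
  proof (rule Suc.IH)
    show "\<not> (sroot b \<in> step K a \<and> sroot a \<in> step K a)"
      using plane_step[of K a b] Suc.prems by blast
    show "beta m b a j \<in> step K a" using beta_step Suc.prems by blast
    show "enat n' < m" using Suc.prems n by (auto intro: less_trans[of _ "enat n"])
  qed (use Suc.prems n M_sym linsub_step in auto)
  then show ?case using a by (simp add: n mixed_Suc)
qed

lemma tau_cancel: "s \<in> S \<Longrightarrow> [tau_letter s, tau_letter s] \<approx> []"
  by (intro cong_va_rels va_rels.v2_square)

text \<open>Conjugating the relation (v3) letter by letter through the dihedral group.\<close>

lemma mixed_cong:
  assumes "a \<in> S" "b \<in> S" "a \<noteq> b" "M a b = enat (Suc n)" "j \<le> n"
  shows "mixed a b n j \<approx> mixed b a n (n - j)"
  using assms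
proof (induction j arbitrary: a b)
  case 0
  have "(if even (Suc n) then a else b) = (if even n then b else a)" by simp
  then show ?case using va_rels.v3[of a S b M "Suc n"] cong_va_rels 0
    by (cases "even n") (simp_all add: mixed_0 mixed_last)
next
  case (Suc j)
  obtain k where n: "n = Suc k" using Suc.prems by (cases n) auto
  have ba: "M b a = enat (Suc n)" using Suc.prems M_sym by metis
  \<comment> \<open>Appending \<open>l\<close> turns the shorter word \<open>mixed b a k j\<close>
    into \<open>mixed b a n j\<close>, to which the induction hypothesis applies. Of the inserted
    pair of letters \<open>l\<close>, the second one becomes the last letter of the result; the two
    letters \<open>tau_letter a\<close> cancel.\<close>
  define l where "l = tau_letter (if even k then a else b)"
  have w: "mixed c d i j' \<in> words (va_gens S)" if "c \<in> S" "d \<in> S" for c d i j'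
    using that by (auto simp: mixed_def words_def)
  have l: "[l] \<in> words (va_gens S)" "[l, l] \<approx> []"
    using tau_cancel Suc.prems by (auto simp: l_def)
  have IH: "mixed b a k j @ [l] \<approx> tau_letter a # mixed b a k (k - j)"
    using Suc.IH[of b a] Suc.prems ba
    by (simp add: n mixed_snoc l_def mixed_Suc Suc_diff_le)
  have "mixed a b n (Suc j) = tau_letter a # mixed b a k j" by (simp add: n mixed_Suc)
  also have "\<dots> \<approx> tau_letter a # (mixed b a k j @ [l]) @ [l]"
    using cong_context[OF l(2), of "tau_letter a # mixed b a k j" "[]"] Suc.prems w
    by (simp add: cong_sym)
  also have "\<dots> \<approx> tau_letter a # (tau_letter a # mixed b a k (k - j)) @ [l]"
    using cong_context[OF IH, of "[tau_letter a]" "[l]"] Suc.prems l by simp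
  also have "\<dots> \<approx> mixed b a k (k - j) @ [l]"
    using cong_context[OF tau_cancel[of a], of "[]" "mixed b a k (k - j) @ [l]"] Suc.prems l w by simp
  also have "mixed b a k (k - j) @ [l] = mixed b a n (n - Suc j)"
    by (simp add: n mixed_snoc l_def)
  finally show ?case .
qed

text \<open>The two sides of (v1) meet the same roots in opposite orders. Both keep all letters,
  none, or the ones at the complementary positions \<open>j\<close> and \<open>n - j\<close>; the
  results are related by (v1), by the braid relation in (v2), or by \<open>mixed_cong\<close>. The
  two sides of (v3) both keep their sigma letter, or both lose it and become the sides of a braid
  relation.\<close>

lemma retr_va_rels:
  assumes "(u, v) \<in> va_rels S M" "linsub K"
  shows "retr K u \<approx> retr K v"
  using assms(1)
proof cases
  case (v1 s t m)
  have m: "m \<ge> 2" using M_ge2_nat v1 by blast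
  then obtain n where n: "m = Suc n" by (cases m) auto
  have ts: "M t s = enat m" using v1 M_sym by metis
  consider "sroot s \<in> K \<and> sroot t \<in> K" | "\<And>i. i < m \<Longrightarrow> beta (enat m) s t i \<notin> K"
    | j where "\<not> (sroot s \<in> K \<and> sroot t \<in> K)" "j < m" "beta (enat m) s t j \<in> K"
    by blast
  then show ?thesis
  proof cases
    case 1
    then show ?thesis using v1 assms(1) cong_va_rels by (simp add: retr_alternating_all)
  next
    case 2
    have "beta (enat m) t s i \<notin> K" if "i < m" for i
      using 2[of "m - Suc i"] beta_swap[OF m, of "m - Suc i" t s] that by simp
    then have "retr K u = alternating (tau_letter s) (tau_letter t) m"
      "retr K v = alternating (tau_letter t) (tau_letter s) m"
      using v1 ts 2 assms(2) by (auto intro!: retr_alternating_none)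
    then show ?thesis using v1 cong_va_rels va_rels.v2_braid by metis
  next
    case 3
    have "beta (enat m) t s (n - j) \<in> K"
      using 3 beta_swap[OF m, of j t s] by (simp add: n)
    then have "retr K v = mixed t s n (n - j)"
      unfolding v1 n using v1 3 ts assms(2) n by (intro retr_alternating_one) auto
    moreover have "retr K u = mixed s t n j"
      unfolding v1 n using v1 3 assms(2) n by (intro retr_alternating_one) auto
    ultimately show ?thesis using mixed_cong[of s t n j] v1 3 n by simp
  qed
next
  case (v2_square s)
  then show ?thesis using tau_cancel by simp
next
  case (v2_braid s t m)
  then show ?thesis
    using retr_tau[of K s t m "[]"] retr_tau[of K t s m "[]"] assms cong_va_rels by simp
next
  case (v3 s t m)
  let ?r = "if even m then s else t"
  have m: "m \<ge> 2" using M_ge2_nat v3 by blast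
  then obtain n where n: "m = Suc n" by (cases m) auto
  have ts: "M t s = enat m" using v3 M_sym by metis
  \<comment> \<open>On the right-hand side the sigma letter comes after the tau word, so its fate is
    decided by this image of its root, which turns out to be the root that decides on the
    left.\<close>
  have "rep (alternating t s n) (sroot ?r) = beta (enat m) t s n"
    using rep_alternating_sroot[of t s n] v3 ts by (cases "even n") (simp_all add: n)
  also have "\<dots> = sroot s"
    using cheb_pred_top[OF m] cheb_top[OF m] by (simp add: beta_def n)
  finally have r: "rep (alternating t s n) (sroot ?r) \<in> K \<longleftrightarrow> sroot s \<in> K" by simp
  show ?thesis
  proof (cases "sroot s \<in> K")
    case True
    have "retr K u = u"
      using True retr_tau[of K t s n "[]"] by (simp add: v3 n)
    moreover have "retr K v = v"
      using True r by (simp add: v3 n retr_tau)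
    ultimately show ?thesis using assms cong_va_rels by simp
  next
    case False
    have "retr K u = alternating (tau_letter s) (tau_letter t) m"
      using False retr_tau[of "step K s" t s n "[]"] by (simp add: v3 n)
    moreover have "retr K v = alternating (tau_letter t) (tau_letter s) n @ [tau_letter ?r]"
      using False r by (simp add: v3 n retr_tau)
    then have "retr K v = alternating (tau_letter t) (tau_letter s) m"
      by (simp add: n alternating_snoc del: alternating.simps)
    ultimately show ?thesis using v3 cong_va_rels va_rels.v2_braid by metis
  qed
qed

lemma state_eq_of_cong: "retr K u \<approx> retr K v \<Longrightarrow> state K u = state K v"
  by (simp add: state_def actK_cong)

text \<open>Congruent outputs act equally and leave the same subspace for the suffix
  \<open>q\<close>, so a local change of the input stays local in the output.\<close>

lemma retr_cong_aux:
  assumes "retr (state K p) u \<approx> retr (state K p) v" "p \<in> words (va_gens S)" "q \<in> words (va_gens S)"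
  shows "retr K (p @ u @ q) \<approx> retr K (p @ v @ q)"
  using assms state_eq_of_cong[OF assms(1)]
  by (simp add: retr_append cong_context retr_words)

text \<open>The induction has to cover every subspace, because a relation inside a word is met in
  the state that its prefix produces.\<close>

lemma retr_cong: "u \<approx> v \<Longrightarrow> linsub K \<Longrightarrow> retr K u \<approx> retr K v"
  unfolding cong_def
proof (induction arbitrary: K rule: pres_cong.induct)
  case (rel u v p q)
  then show ?case
    unfolding cong_def[symmetric] by (intro retr_cong_aux retr_va_rels linsub_state)
next
  case (cancel a p q e)
  let ?K = "state K p"
  have "retr ?K [(a, e), (a, \<not> e)] \<approx> retr ?K []"
    using cong_cancel[of _ e] cancel.hyps(1) sroot_step_self[OF linsub_state[OF cancel.prems]]
    by (cases a) auto
  then have "retr K (p @ [(a, e), (a, \<not> e)] @ q) \<approx> retr K (p @ [] @ q)"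
    using cancel by (intro retr_cong_aux)
  then show ?case by (simp add: cong_def)
next
  case (refl u)
  then show ?case by (simp add: pres_cong.refl retr_words)
next
  case (sym u v)
  then show ?case by (blast intro: pres_cong.sym)
next
  case (trans u v w)
  then show ?case by (meson pres_cong.trans)
qed

lemma step_supported:
  assumes "x \<in> X" "x \<in> S"
  shows "step (supported X) x = supported X"
proof -
  have "reflect x v \<in> supported X \<longleftrightarrow> v \<in> supported X" for v
    using assms by (auto simp: supported_def reflect_def sroot_def)
  then show ?thesis by (simp add: step_def)
qed

lemma retr_parabolic:
  assumes "X \<subseteq> S" "w \<in> words (va_gens X)"
  shows "retr (supported X) w = w"
  using assms(2)
proof (induction w)
  case (Cons l w)
  obtain g e where l: "l = (g, e)" by (cases l)
  show ?case
  proof (cases g)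
    case (Sigma_gen s)
    moreover have "sroot s \<in> supported X" using Sigma_gen l Cons.prems by (auto simp: sroot_def supported_def)
    ultimately show ?thesis using Cons l by simp
  next
    case (Tau_gen s)
    then show ?thesis using Cons l assms(1) step_supported[of s X] by auto
  qed
qed simp

text \<open>Rewriting respects congruence and fixes \<open>x\<close>. The rewriting of
  \<open>w\<close> itself need not be a word over \<open>X\<close>; the factorisation
  \<open>factor_retr\<close> deals with that.\<close>

lemma cong_retr_supported:
  assumes "X \<subseteq> S" "x \<in> words (va_gens X)" "w \<approx> x"
  shows "w \<approx> retr (supported X) w"
  using retr_cong[OF assms(3) linsub_supported, of X] retr_parabolic[OF assms(1,2)] assms(3)
  by (metis cong_sym cong_trans)

section \<open>Lengths and positive roots\<close>

lemma actK_tword [simp]: "actK (tword u) x = rep u x"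
  by (induction u) auto

lemma rep_cong: "tword u \<approx> tword v \<Longrightarrow> rep u x = rep v x"
  using actK_cong[of "tword u" "tword v" x] by simp

lemma cong_inverse: "w \<in> words (va_gens S) \<Longrightarrow> map (apsnd Not) (rev w) @ w \<approx> []"
  unfolding cong_def by (rule pres_cong_inverse)

lemma cong_tword_lists: "tword u \<approx> tword v \<Longrightarrow> u \<in> lists S \<and> v \<in> lists S"
  using cong_words[of "tword u" "tword v"] by simp

lemma tword_rev_cancel: "u \<in> lists S \<Longrightarrow> tword u @ tword (rev u) \<approx> []"
proof (induction u)
  case (Cons s u)
  then have "[tau_letter s] @ (tword u @ tword (rev u)) @ [tau_letter s] \<approx> [tau_letter s] @ [] @ [tau_letter s]"
    by (intro cong_context) auto
  also have "[tau_letter s] @ [] @ [tau_letter s] \<approx> []" using tau_cancel Cons by simp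
  finally show ?case by simp
qed (simp add: cong_refl)

lemma tword_rev_cancel': "u \<in> lists S \<Longrightarrow> tword (rev u) @ tword u \<approx> []"
  using tword_rev_cancel[of "rev u"] by simp

lemma cong_inverse_unique:
  assumes "u \<approx> v" "u @ u' \<approx> []" "v' @ v \<approx> []"
  shows "u' \<approx> v'"
proof -
  have w: "u' \<in> words (va_gens S)" "v' \<in> words (va_gens S)"
    using cong_words[OF assms(2)] cong_words[OF assms(3)] by auto
  have "u' \<approx> (v' @ v) @ u'"
    using cong_context[OF assms(3), of "[]" u'] w cong_sym by auto
  also have "(v' @ v) @ u' \<approx> (v' @ u) @ u'"
    using cong_context[OF cong_sym[OF assms(1)], of v' u'] w by simp
  also have "(v' @ u) @ u' \<approx> v'"
    using cong_context[OF assms(2), of v' "[]"] w by simp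
  finally show ?thesis .
qed

lemma tword_rev_cong:
  assumes "tword u \<approx> tword v"
  shows "tword (rev u) \<approx> tword (rev v)"
  by (rule cong_inverse_unique[OF assms])
    (use cong_tword_lists[OF assms] tword_rev_cancel[of u] tword_rev_cancel'[of v] in simp_all)

text \<open>The Coxeter length measured inside VA: only words in the tau letters compete, but they
  are compared by the congruence of the whole virtual Artin group.\<close>

definition len :: "'s list \<Rightarrow> nat" where
  "len u = (LEAST n. \<exists>v. tword v \<approx> tword u \<and> length v = n)"

lemma len_le: "tword v \<approx> tword u \<Longrightarrow> len u \<le> length v"
  unfolding len_def by (rule Least_le) blast

lemma obtain_reduced:
  assumes "u \<in> lists S"
  obtains v where "v \<in> lists S" "tword v \<approx> tword u" "length v = len u"
proof -
  have "\<exists>v. tword v \<approx> tword u \<and> length v = len u"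
    unfolding len_def by (rule LeastI[of _ "length u"], rule exI[of _ u]) (simp add: cong_refl assms)
  then show ?thesis using that cong_tword_lists by blast
qed

lemma len_cong:
  assumes "tword u \<approx> tword v"
  shows "len u = len v"
proof -
  have "len u \<le> len v" if uv: "tword u \<approx> tword v" for u v
  proof -
    obtain w where w: "tword w \<approx> tword v" "length w = len v"
      using obtain_reduced[of v] cong_tword_lists[OF uv] by metis
    show ?thesis using len_le[OF cong_trans[OF w(1) cong_sym[OF uv]]] w(2) by simp
  qed
  from this[OF assms] this[OF cong_sym[OF assms]] show ?thesis by simp
qed

lemma len_rev:
  assumes "u \<in> lists S" shows "len (rev u) = len u"
proof -
  have "len (rev u) \<le> len u" if "u \<in> lists S" for u
  proof -
    obtain v where "tword v \<approx> tword u" "length v = len u" using obtain_reduced \<open>u \<in> lists S\<close> by blast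
    then show ?thesis using len_le[OF tword_rev_cong, of v u] by simp
  qed
  from this[of u] this[of "rev u"] assms show ?thesis by (simp add: order_antisym)
qed

lemma len_eq_0:
  assumes "u \<in> lists S" "len u = 0"
  shows "tword u \<approx> []"
proof -
  obtain v where "tword v \<approx> tword u" "length v = 0"
    using obtain_reduced[OF assms(1)] assms(2) by metis
  then show ?thesis using cong_sym by simp
qed

lemma tword_snoc_cancel:
  assumes "u \<in> lists S" "s \<in> S"
  shows "tword (u @ [s, s]) \<approx> tword u"
  using cong_context[OF tau_cancel[OF assms(2)], of "tword u" "[]"] assms by simp

lemma tword_cong_append:
  assumes "tword u \<approx> tword v" "p \<in> lists S" "q \<in> lists S"
  shows "tword (p @ u @ q) \<approx> tword (p @ v @ q)"
  using cong_context[OF assms(1), of "tword p" "tword q"] assms by simp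

lemma obtain_descent:
  assumes "u \<in> lists S" "len u > 0"
  obtains t where "t \<in> S" "len (u @ [t]) < len u"
proof -
  obtain v where v: "v \<in> lists S" "tword v \<approx> tword u" "length v = len u"
    using obtain_reduced assms by blast
  then obtain v' t where v': "v = v' @ [t]" using assms by (cases v rule: rev_cases) auto
  then have *: "v' \<in> lists S" "t \<in> S" using v by auto
  have "tword v' \<approx> tword (v @ [t])" using cong_sym[OF tword_snoc_cancel[OF *]] v' by simp
  also have "tword (v @ [t]) \<approx> tword (u @ [t])"
    using tword_cong_append[OF v(2), of "[]" "[t]"] * by simp
  finally have "len (u @ [t]) \<le> length v'" by (rule len_le)
  then show ?thesis using that * v v' by simp
qed

lemma rev_alternating_cong:
  assumes "s \<in> S" "t \<in> S" "s \<noteq> t" "M s t = enat m"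
  shows "tword (rev (alternating t s m)) \<approx> tword (rev (alternating s t m))"
proof -
  have "tword (alternating s t m) \<approx> tword (alternating t s m)"
    using va_rels.v2_braid[of s S t M m] assms cong_va_rels by (simp add: map_alternating)
  then show ?thesis by (auto simp: rev_alternating intro: cong_sym)
qed

text \<open>The coset decomposition along the dihedral subgroup of \<open>s\<close> and
  \<open>t\<close>: \<open>v\<close> has neither as a descent, and the second factor ends in
  \<open>t\<close>. That factor is not the longest dihedral element, since then \<open>s\<close>
  would be a descent of \<open>u\<close> too; hence \<open>enat k < M s t\<close>.\<close>

lemma dihedral_decomposition:
  assumes u: "u \<in> lists S" and st: "s \<in> S" "t \<in> S" "s \<noteq> t"
    and less: "len (u @ [t]) < len u" and ge: "len u \<le> len (u @ [s])"
  obtains v k where "v \<in> lists S" "0 < k" "enat k < M s t"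
    "tword u \<approx> tword (v @ rev (alternating t s k))"
    "len v < len u" "len v \<le> len (v @ [s])" "len v \<le> len (v @ [t])"
proof -
  \<comment> \<open>Factorisations of \<open>u\<close> in which the lengths add up to
    \<open>len u\<close>; below, one with the shortest first factor is chosen.\<close>
  define P where "P n \<longleftrightarrow> (\<exists>v d. v \<in> lists S \<and> set d \<subseteq> {s, t} \<and> length v = n \<and>
    n + length d = len u \<and> tword u \<approx> tword (v @ d))" for n
  have min_len: "len u \<le> length p" if "tword u \<approx> tword p" for p
    using that len_le cong_sym by blast
  have st_lists: "d \<in> lists S" if "set d \<subseteq> {s, t}" for d using that st by auto
  obtain v1 where v1: "v1 \<in> lists S" "tword v1 \<approx> tword (u @ [t])" "length v1 = len (u @ [t])"
    using obtain_reduced[of "u @ [t]"] u st by auto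
  have "tword u \<approx> tword (u @ [t, t])" using tword_snoc_cancel u st cong_sym by blast
  also have "tword (u @ [t, t]) \<approx> tword (v1 @ [t])"
    using tword_cong_append[OF cong_sym[OF v1(2)], of "[]" "[t]"] st by simp
  finally have u1: "tword u \<approx> tword (v1 @ [t])" .
  have l1: "Suc (length v1) = len u" using min_len[OF u1] v1 less by simp
  have P1: "P (length v1)" unfolding P_def
    by (rule exI[of _ v1], rule exI[of _ "[t]"]) (use v1 u1 l1 in auto)
  define n where "n = (LEAST n. P n)"
  have n: "P n" "n \<le> length v1" "\<And>i. P i \<Longrightarrow> n \<le> i"
    unfolding n_def using P1 by (auto intro: LeastI Least_le)
  obtain v d where v: "v \<in> lists S" "length v = n" and d: "set d \<subseteq> {s, t}" "n + length d = len u"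
    and uvd: "tword u \<approx> tword (v @ d)"
    using n(1) unfolding P_def by blast
  have lv: "len v = n"
  proof -
    obtain v' where v': "v' \<in> lists S" "tword v' \<approx> tword v" "length v' = len v"
      using obtain_reduced v by blast
    have "tword u \<approx> tword (v' @ d)"
      using uvd tword_cong_append[OF cong_sym[OF v'(2)], of "[]" d] st_lists[OF d(1)]
      by (auto intro: cong_trans)
    then have "len u \<le> len v + length d" using min_len[of "v' @ d"] v' by simp
    then show ?thesis using d(2) len_le[OF cong_refl, of v] v by simp
  qed
  \<comment> \<open>A descent \<open>r\<close> of \<open>v\<close> could be moved to the front of
    \<open>d\<close>, giving a shorter first factor.\<close>
  have asc: "len v \<le> len (v @ [r])" if r: "r \<in> {s, t}" for r
  proof (rule ccontr)
    assume neg: "\<not> ?thesis"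
    have rS: "r \<in> S" using r st by auto
    obtain v' where v': "v' \<in> lists S" "tword v' \<approx> tword (v @ [r])" "length v' = len (v @ [r])"
      using obtain_reduced[of "v @ [r]"] v rS by auto
    have "tword (v @ d) \<approx> tword (v @ [r, r] @ d)"
      using tword_cong_append[OF cong_sym[OF tword_snoc_cancel[OF v(1) rS]], of "[]" d] st_lists[OF d(1)]
      by simp
    also have "tword (v @ [r, r] @ d) \<approx> tword (v' @ r # d)"
      using tword_cong_append[OF cong_sym[OF v'(2)], of "[]" "r # d"] st_lists[OF d(1)] rS by simp
    finally have uv': "tword u \<approx> tword (v' @ r # d)" using uvd cong_trans by blast
    have "len u \<le> length v' + Suc (length d)" using min_len[OF uv'] by simp
    then have "length v' + length (r # d) = len u" using neg v' lv d by simp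
    then have "P (length v')" unfolding P_def using v' d uv' r by (intro exI[of _ v'] exI[of _ "r # d"]) auto
    then show False using n(3) neg v' lv by fastforce
  qed
  have dne: "d \<noteq> []" using n(2) l1 d(2) by auto
  have last_d: "last d = t"
  proof (rule ccontr)
    assume "last d \<noteq> t"
    then have "last d = s" using d(1) dne last_in_set[of d] by blast
    then obtain d' where d': "d = d' @ [s]" using dne append_butlast_last_id by metis
    have vd': "v @ d' \<in> lists S" using v st_lists[OF d(1)] d' by simp
    have "tword (u @ [s]) \<approx> tword (v @ d' @ [s, s])"
      using tword_cong_append[OF uvd, of "[]" "[s]"] st d' by simp
    also have "tword (v @ d' @ [s, s]) \<approx> tword (v @ d')"
      using tword_snoc_cancel[OF vd' st(1)] by simp
    finally have "len (u @ [s]) \<le> length (v @ d')" using cong_sym len_le by blast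
    then show False using ge d d' v by simp
  qed
  have "rev d = alternating t s (length (rev d))"
  proof (rule alternatingI)
    show "hd (rev d) = t" using last_d by (simp add: hd_rev)
    show "rev d \<noteq> p @ [x, x] @ q" for p x q
    proof
      assume a: "rev d = p @ [x, x] @ q"
      have "d = rev (rev d)" by simp
      then have dd: "d = rev q @ [x, x] @ rev p" unfolding a by simp
      have S: "v @ rev q \<in> lists S" "x \<in> S" "rev p \<in> lists S" using v st_lists[OF d(1)] dd by auto
      have "tword (v @ d) \<approx> tword (v @ rev q @ rev p)"
        using tword_cong_append[OF tword_snoc_cancel[OF S(1,2)], of "[]" "rev p"] S dd by simp
      then have "tword u \<approx> tword (v @ rev q @ rev p)" using uvd cong_trans by blast
      from min_len[OF this] show False using d dd v by simp
    qed
  qed (use d dne in auto)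
  then have "rev (rev d) = rev (alternating t s (length (rev d)))" by (rule arg_cong)
  then have d_alt: "d = rev (alternating t s (length d))" by simp
  \<comment> \<open>From length \<open>m\<close> on, the braid relation would give \<open>d\<close>
    a form that ends in \<open>s\<close>, and \<open>s\<close> would shorten
    \<open>u\<close>.\<close>
  have "enat (length d) < M s t"
  proof (rule ccontr)
    assume "\<not> ?thesis"
    then obtain m where m: "M s t = enat m" "m \<le> length d" by (cases "M s t") auto
    then have m2: "m \<ge> 2" using M_ge2_nat st by blast
    obtain r where r: "alternating t s (length d) = alternating t s m @ r" "set r \<subseteq> {t, s}"
      using alternating_append_ex[OF m(2), of t s] by blast
    obtain m' where m': "m = Suc m'" using m2 by (cases m) auto
    have alt': "rev (alternating s t m) = rev (alternating t s m') @ [s]" by (simp add: m')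
    have S: "v @ rev r \<in> lists S" using v st_lists[of "rev r"] r by auto
    have "d = rev r @ rev (alternating t s m)" using d_alt r(1) by simp
    moreover have "tword (rev r @ rev (alternating t s m)) \<approx> tword (rev r @ rev (alternating s t m))"
      using tword_cong_append[OF rev_alternating_cong[OF st m(1)], of "rev r" "[]"] S by simp
    ultimately have "tword d \<approx> tword (rev r @ rev (alternating s t m))" by simp
    then have "tword (v @ d) \<approx> tword (v @ rev r @ rev (alternating s t m))"
      using tword_cong_append[of d "rev r @ rev (alternating s t m)" v "[]"] v(1) by simp
    from cong_trans[OF uvd this] have ud: "tword u \<approx> tword (v @ rev r @ rev (alternating t s m') @ [s])"
      by (simp add: alt')
    let ?p = "v @ rev r @ rev (alternating t s m')"
    have S': "?p \<in> lists S" using S set_alternating[of t s m'] st by (auto simp: in_lists_conv_set)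
    have "tword (u @ [s]) \<approx> tword (?p @ [s, s])"
      using tword_cong_append[OF ud, of "[]" "[s]"] st by simp
    also have "tword (?p @ [s, s]) \<approx> tword ?p" using tword_snoc_cancel[OF S' st(1)] .
    finally have "len (u @ [s]) \<le> length ?p" using cong_sym len_le by blast
    moreover have "length d = length r + m" using arg_cong[OF r(1), of length] by simp
    ultimately show False using ge d v m' by simp
  qed
  with that[of v "length d"] v dne uvd d_alt lv n l1 asc show ?thesis by auto
qed

lemma rep_rev_alternating:
  assumes "s \<in> S" "t \<in> S" "s \<noteq> t"
  shows "rep (rev (alternating t s k)) (sroot s) =
    beta (M s t) (if even k then s else t) (if even k then t else s) k"
  using rep_alternating_sroot[of s t k] rep_alternating_sroot[of t s k] assms M_sym[of s t]
  by (cases "even k") (simp_all add: rev_alternating)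

lemma rep_beta:
  "rep u (beta m a b k) = (\<lambda>i. cheb m (Suc k) * rep u (sroot a) i + cheb m k * rep u (sroot b) i)"
  unfolding beta_def by (rule linfun_comb[OF linfun_rep])

text \<open>The dihedral factor takes the root of \<open>s\<close> to a combination of the two
  simple roots with coefficients \<open>cheb\<close> at \<open>k\<close> and \<open>Suc k\<close>,
  nonnegative because \<open>k\<close> is below \<open>M s t\<close>. The shorter \<open>v\<close>
  sends both roots to nonnegative vectors by induction.\<close>

lemma rep_sroot_nonneg:
  "u \<in> lists S \<Longrightarrow> s \<in> S \<Longrightarrow> len u \<le> len (u @ [s]) \<Longrightarrow> nonneg (rep u (sroot s))"
proof (induction "len u" arbitrary: u s rule: less_induct)
  case less
  show ?case
  proof (cases "len u = 0")
    case True
    then have "rep u (sroot s) = rep [] (sroot s)"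
      using len_eq_0 less.prems by (intro rep_cong) simp
    then show ?thesis by (simp add: nonneg_def sroot_def)
  next
    case False
    then obtain t where t: "t \<in> S" "len (u @ [t]) < len u" using obtain_descent less.prems by blast
    then have st: "s \<noteq> t" using less.prems by auto
    obtain v k where v: "v \<in> lists S" "0 < k" "enat k < M s t"
      "tword u \<approx> tword (v @ rev (alternating t s k))"
      "len v < len u" "len v \<le> len (v @ [s])" "len v \<le> len (v @ [t])"
      using dihedral_decomposition[OF less.prems(1,2) t(1) st t(2) less.prems(3)] by blast
    have nn: "nonneg (rep v (sroot s))" "nonneg (rep v (sroot t))"
      using less.hyps v less.prems t by blast+
    have m: "M s t \<ge> 2" using M_ge2 less.prems t st by blast
    have "cheb (M s t) k \<ge> 0" "cheb (M s t) (Suc k) \<ge> 0"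
      using cheb_pos[OF m v(2,3)] cheb_nonneg[OF m v(3)] by auto
    moreover have "rep u (sroot s) = rep v (rep (rev (alternating t s k)) (sroot s))"
      using rep_cong[OF v(4)] by simp
    ultimately show ?thesis using nn less.prems t st
      by (auto simp: rep_rev_alternating rep_beta nonneg_def)
  qed
qed

lemma rep_sroot_nonpos:
  assumes "u \<in> lists S" "s \<in> S" "len (u @ [s]) < len u"
  shows "nonneg (\<lambda>i. - rep u (sroot s) i)"
proof -
  have "len (u @ [s, s]) = len u" using tword_snoc_cancel assms len_cong by blast
  then have "nonneg (rep (u @ [s]) (sroot s))"
    using assms by (intro rep_sroot_nonneg) auto
  moreover have "rep (u @ [s]) (sroot s) = (\<lambda>i. - rep u (sroot s) i)"
    using linfun_scale[OF linfun_rep, of u "-1" "sroot s"] assms by (simp add: reflect_sroot_self)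
  ultimately show ?thesis by simp
qed

lemma rep_inject: "u \<in> lists S \<Longrightarrow> rep u v = rep u w \<Longrightarrow> v = w"
  using rep_rev_cancel[of u v] rep_rev_cancel[of u w] by metis
lemma rep_zero: "rep u (\<lambda>i. 0) = (\<lambda>i. 0)"
  using linfun_scale[OF linfun_rep, of u 0 "\<lambda>i. 0"] by (simp only: mult_zero_left)

lemma rep_sroot_nonzero: "u \<in> lists S \<Longrightarrow> rep u (sroot s) \<noteq> (\<lambda>i. 0)"
proof
  assume "u \<in> lists S" "rep u (sroot s) = (\<lambda>i. 0)"
  then have "rep u (sroot s) = rep u (\<lambda>i. 0)" using rep_zero[of u] by metis
  with \<open>u \<in> lists S\<close> have "sroot s = (\<lambda>i. 0)" by (rule rep_inject)
  from fun_cong[OF this, of s] show False by (simp add: sroot_def)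
qed

section \<open>Conjugates of the sigma generators by tau words\<close>

lemma sigma_alternating_conj:
  assumes "s \<in> S" "t \<in> S" "s \<noteq> t" "M s t = enat (Suc k)"
  shows "tword (rev (alternating t s k)) @ [sigma_letter s] \<approx>
    sigma_letter (if even k then t else s) # tword (rev (alternating t s k))"
proof -
  have ts: "M t s = enat (Suc k)" using assms M_sym by metis
  show ?thesis
  proof (cases "even k")
    case True
    then show ?thesis
      using cong_va_rels[OF va_rels.v3[of t S s M "Suc k"]] assms ts
      by (simp add: rev_alternating map_alternating cong_sym)
  next
    case False
    then show ?thesis
      using cong_va_rels[OF va_rels.v3[of s S t M "Suc k"]] assms ts
      by (simp add: rev_alternating map_alternating cong_sym)
  qed
qed

text \<open>With u = v d from the dihedral decomposition, the image of the root is a nonnegative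
  combination of the nonnegative vectors v(alpha_p) and v(alpha_q). As it lies on one axis, the
  coefficient at p must vanish. So d has length \<open>M s t\<close> minus 1, relation (v3) carries
  sigma_s through d to sigma_q, and v is left to the induction.\<close>

lemma conj_simple_root:
  "u \<in> lists S \<Longrightarrow> s \<in> S \<Longrightarrow> x \<in> S \<Longrightarrow> nonneg (rep u (sroot s)) \<Longrightarrow> rep u (sroot s) \<in> supported {x}
    \<Longrightarrow> tword u @ [sigma_letter s] \<approx> sigma_letter x # tword u"
proof (induction "len u" arbitrary: u s rule: less_induct)
  case less
  have asc: "len u \<le> len (u @ [s])"
  proof (rule ccontr)
    assume "\<not> ?thesis"
    then have "nonneg (\<lambda>i. - rep u (sroot s) i)" using rep_sroot_nonpos less.prems by simp
    then have "rep u (sroot s) = (\<lambda>i. 0)"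
      using less.prems(4) by (auto simp: nonneg_def intro!: ext order_antisym)
    then show False using rep_sroot_nonzero less.prems by blast
  qed
  show ?case
  proof (cases "len u = 0")
    case True
    then have e: "tword u \<approx> []" using len_eq_0 less.prems by blast
    then have "rep u (sroot s) = rep [] (sroot s)" by (intro rep_cong) simp
    then have "s = x" using less.prems(5) by (auto simp: supported_def sroot_def)
    moreover have "tword u @ [sigma_letter s] \<approx> [sigma_letter s]" "[sigma_letter s] \<approx> sigma_letter s # tword u"
      using cong_context[OF e, of "[]" "[sigma_letter s]"]
        cong_context[OF cong_sym[OF e], of "[sigma_letter s]" "[]"] less.prems by auto
    ultimately show ?thesis using cong_trans by blast
  next
    case False
    then obtain t where t: "t \<in> S" "len (u @ [t]) < len u" using obtain_descent less.prems by blast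
    then have st: "s \<noteq> t" using asc by auto
    obtain v k where v: "v \<in> lists S" "0 < k" "enat k < M s t"
      "tword u \<approx> tword (v @ rev (alternating t s k))"
      "len v < len u" "len v \<le> len (v @ [s])" "len v \<le> len (v @ [t])"
      using dihedral_decomposition[OF less.prems(1,2) t(1) st t(2) asc] by blast
    have nn: "nonneg (rep v (sroot s))" "nonneg (rep v (sroot t))"
      using rep_sroot_nonneg v less.prems t by blast+
    have m: "M s t \<ge> 2" using M_ge2 less.prems t st by blast
    define p q where "p = (if even k then s else t)" and "q = (if even k then t else s)"
    have pq: "p \<in> S" "q \<in> S" "p \<noteq> q" "nonneg (rep v (sroot p))" "nonneg (rep v (sroot q))"
      using nn less.prems t st by (auto simp: p_def q_def)
    have ck: "cheb (M s t) k > 0" and ck': "cheb (M s t) (Suc k) \<ge> 0"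
      using cheb_pos[OF m v(2,3)] cheb_nonneg[OF m v(3)] by auto
    have "rep u (sroot s) = rep v (rep (rev (alternating t s k)) (sroot s))"
      using rep_cong[OF v(4)] by simp
    then have eq: "rep u (sroot s) = (\<lambda>i. cheb (M s t) (Suc k) * rep v (sroot p) i + cheb (M s t) k * rep v (sroot q) i)"
      using less.prems t st by (simp add: rep_rev_alternating rep_beta p_def q_def)
    have zero: "cheb (M s t) (Suc k) * rep v (sroot p) i = 0 \<and> cheb (M s t) k * rep v (sroot q) i = 0"
      if "i \<noteq> x" for i
    proof -
      have "cheb (M s t) (Suc k) * rep v (sroot p) i + cheb (M s t) k * rep v (sroot q) i = 0"
        using less.prems(5) eq that by (auto simp: supported_def)
      moreover have "cheb (M s t) (Suc k) * rep v (sroot p) i \<ge> 0" "cheb (M s t) k * rep v (sroot q) i \<ge> 0"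
        using ck ck' pq by (auto simp: nonneg_def)
      ultimately show ?thesis by linarith
    qed
    have q_supp: "rep v (sroot q) \<in> supported {x}" using zero ck by (auto simp: supported_def)
    \<comment> \<open>Otherwise v(alpha_p) and v(alpha_q) would lie on the same axis, although v is
      injective and the two simple roots are independent.\<close>
    have "cheb (M s t) (Suc k) = 0"
    proof (rule ccontr)
      assume nz: "cheb (M s t) (Suc k) \<noteq> 0"
      then have p_supp: "rep v (sroot p) \<in> supported {x}" using zero by (auto simp: supported_def)
      define a b where "a = rep v (sroot p) x" and "b = rep v (sroot q) x"
      have "rep v (\<lambda>i. b * sroot p i + (- a) * sroot q i) = (\<lambda>i. b * rep v (sroot p) i + (- a) * rep v (sroot q) i)"
        by (rule linfun_comb[OF linfun_rep])
      also have "\<dots> = (\<lambda>i. 0)"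
      proof
        fix i
        show "b * rep v (sroot p) i + (- a) * rep v (sroot q) i = 0"
          using p_supp q_supp by (cases "i = x") (auto simp: supported_def a_def b_def)
      qed
      finally have "(\<lambda>i. b * sroot p i + (- a) * sroot q i) = (\<lambda>i. 0)"
        by (rule rep_inject[OF v(1), OF HOL.trans[OF _ rep_zero[symmetric]]])
      from fun_cong[OF this, of p] pq have "b = 0" by (simp add: sroot_def)
      then have "rep v (sroot q) = (\<lambda>i. 0)"
        using q_supp by (auto simp: supported_def b_def)
      then show False using rep_sroot_nonzero v by blast
    qed
    then have "\<not> enat (Suc k) < M s t" using cheb_pos[OF m, of "Suc k"] by auto
    then have "M s t = enat (Suc k)" using v(3) by (cases "M s t") auto
    then have conj: "tword (rev (alternating t s k)) @ [sigma_letter s] \<approx> sigma_letter q # tword (rev (alternating t s k))"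
      using sigma_alternating_conj less.prems t st by (simp add: q_def)
    have IH: "tword v @ [sigma_letter q] \<approx> sigma_letter x # tword v"
      using less.hyps[OF v(5) v(1) pq(2) less.prems(3) pq(5) q_supp] .
    let ?d = "rev (alternating t s k)"
    have d: "tword ?d \<in> words (va_gens S)"
      using less.prems t set_alternating[of t s k] by (auto simp: in_lists_conv_set)
    have "tword u @ [sigma_letter s] \<approx> tword v @ tword ?d @ [sigma_letter s]"
      using cong_context[OF v(4), of "[]" "[sigma_letter s]"] less.prems by simp
    also have "\<dots> \<approx> tword v @ sigma_letter q # tword ?d"
      using cong_context[OF conj, of "tword v" "[]"] v(1) by simp
    also have "\<dots> \<approx> sigma_letter x # tword v @ tword ?d"
      using cong_context[OF IH, of "[]" "tword ?d"] d by simp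
    also have "\<dots> \<approx> sigma_letter x # tword u"
      using cong_context[OF cong_sym[OF v(4)], of "[sigma_letter x]" "[]"] less.prems by simp
    finally show ?thesis .
  qed
qed

text \<open>A left descent of u in X is peeled off and put into x; V_X is stable under its
  reflection. Without such descents, u^-1 sends every alpha_a with a in X to a nonnegative vector.
  Writing u(alpha_s) as a sum of c_a alpha_a and applying u^-1 expresses alpha_s through these
  vectors. A simple root does not decompose, so u(alpha_s) lies on a single axis and
  \<open>conj_simple_root\<close> applies.\<close>

lemma conj_parabolic_root_pos:
  "u \<in> lists S \<Longrightarrow> s \<in> S \<Longrightarrow> X \<subseteq> S \<Longrightarrow> rep u (sroot s) \<in> supported X \<Longrightarrow>
    \<exists>x\<in>lists X. \<exists>y\<in>X. length x \<le> len u \<and>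
      tword u @ [sigma_letter s] @ tword (rev u) \<approx> tword x @ [sigma_letter y] @ tword (rev x)"
proof (induction "len u" arbitrary: u rule: less_induct)
  case less
  show ?case
  proof (cases "\<exists>a\<in>X. len (a # u) < len u")
    case True
    then obtain a where a: "a \<in> X" "len (a # u) < len u" by blast
    have aS: "a \<in> S" using a less.prems by auto
    have "rep (a # u) (sroot s) \<in> supported X"
      using step_supported[OF a(1) aS] less.prems(4) by (auto simp: step_def)
    then obtain x y where xy: "x \<in> lists X" "y \<in> X" "length x \<le> len (a # u)"
      "tword (a # u) @ [sigma_letter s] @ tword (rev (a # u)) \<approx> tword x @ [sigma_letter y] @ tword (rev x)"
      using less.hyps[OF a(2)] less.prems aS by auto
    let ?c = "tword u @ [sigma_letter s] @ tword (rev u)"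
    have c: "?c \<in> words (va_gens S)" using less.prems by simp
    have aa: "[tau_letter a, tau_letter a] \<approx> []" using tau_cancel aS .
    have "?c \<approx> [tau_letter a, tau_letter a] @ ?c"
      using cong_context[OF cong_sym[OF aa], of "[]" ?c] c by simp
    also have "\<dots> \<approx> [tau_letter a, tau_letter a] @ ?c @ [tau_letter a, tau_letter a]"
      using cong_context[OF cong_sym[OF aa], of "[tau_letter a, tau_letter a] @ ?c" "[]"] c aS by simp
    also have "\<dots> \<approx> tword (a # x) @ [sigma_letter y] @ tword (rev (a # x))"
      using cong_context[OF xy(4), of "[tau_letter a]" "[tau_letter a]"] aS by simp
    finally show ?thesis using xy a by (intro bexI[of _ "a # x"] bexI[of _ y]) auto
  next
    case False
    define g where "g = (\<lambda>a. rep (rev u) (sroot a))"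
    define c where "c = rep u (sroot s)"
    have fX: "finite X" using less.prems(3) finite_S finite_subset by blast
    have g: "nonneg (g a)" if "a \<in> X" for a
    proof -
      have "len (rev u @ [a]) = len (a # u)"
        using len_rev[of "a # u"] less.prems that by auto
      then have "len (rev u) \<le> len (rev u @ [a])"
        using False that len_rev[of u] less.prems by auto
      then show ?thesis unfolding g_def using less.prems that by (intro rep_sroot_nonneg) auto
    qed
    have sum: "sroot s i = (\<Sum>a\<in>X. c a * g a i)" for i
    proof -
      have "sroot s = rep (rev u) c" using rep_rev_cancel less.prems by (simp add: c_def)
      then show ?thesis
        using linfun_supported_sum[OF linfun_rep fX, of c "rev u" i] less.prems(4) by (simp add: c_def g_def)
    qed
    \<comment> \<open>A root is nonnegative or nonpositive. In the second case the coordinate of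
      \<open>sroot s\<close> at \<open>s\<close>, which is 1, would be a sum of nonpositive
      terms.\<close>
    have cpos: "nonneg c"
    proof (cases "len u \<le> len (u @ [s])")
      case True
      then show ?thesis unfolding c_def using rep_sroot_nonneg less.prems by blast
    next
      case neg: False
      have "nonneg (\<lambda>i. - c i)" unfolding c_def using rep_sroot_nonpos less.prems neg by simp
      then have "(\<Sum>a\<in>X. c a * g a s) \<le> 0"
        using g by (intro sum_nonpos) (auto simp: nonneg_def mult_nonpos_nonneg)
      then show ?thesis using sum[of s] by (simp add: sroot_def)
    qed
    have "c \<noteq> (\<lambda>i. 0)" unfolding c_def using rep_sroot_nonzero less.prems by blast
    then obtain a where a0: "c a \<noteq> 0" by auto
    then have a: "a \<in> X" "c a > 0"
      using less.prems(4) cpos by (auto simp: c_def supported_def nonneg_def order_less_le)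
    \<comment> \<open>Nonnegative terms add up to a coordinate of \<open>sroot s\<close> that is 0,
      and the coefficient \<open>c a\<close> is positive.\<close>
    have ga: "g a i = 0" if "i \<noteq> s" for i
    proof -
      have "(\<Sum>b\<in>X. c b * g b i) = 0" using sum[of i] that by (simp add: sroot_def)
      moreover have "\<And>b. b \<in> X \<Longrightarrow> c b * g b i \<ge> 0" using cpos g by (auto simp: nonneg_def)
      ultimately have "c a * g a i = 0" using sum_nonneg_eq_0_iff[OF fX, of "\<lambda>b. c b * g b i"] a by auto
      then show ?thesis using a by simp
    qed
    have "g a = (\<lambda>i. g a s * sroot s i)" using ga by (auto simp: sroot_def)
    moreover have "sroot a = rep u (g a)" using rep_rev_cancel' less.prems by (simp add: g_def)
    ultimately have "sroot a = (\<lambda>i. g a s * c i)"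
      using linfun_scale[OF linfun_rep, of u "g a s" "sroot s"] by (simp add: c_def)
    then have sa: "sroot a i = g a s * c i" for i by (rule fun_cong)
    have "g a s \<noteq> 0" using sa[of a] by (auto simp: sroot_def)
    then have "c i = 0" if "i \<noteq> a" for i using sa[of i] that by (simp add: sroot_def)
    then have "c \<in> supported {a}" by (simp add: supported_def)
    then have *: "tword u @ [sigma_letter s] \<approx> sigma_letter a # tword u"
      using conj_simple_root[of u s a] cpos less.prems a by (auto simp: c_def)
    have "tword u @ [sigma_letter s] @ tword (rev u) \<approx> sigma_letter a # tword u @ tword (rev u)"
      using cong_context[OF *, of "[]" "tword (rev u)"] less.prems by simp
    also have "\<dots> \<approx> [sigma_letter a]"
      using cong_context[OF tword_rev_cancel, of u "[sigma_letter a]" "[]"] less.prems a by auto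
    finally show ?thesis using a by (intro bexI[of _ "[]"] bexI[of _ a]) auto
  qed
qed

lemma conj_word_inverse:
  assumes "u \<in> lists S" "s \<in> S"
  shows "(tword u @ [(Sigma_gen s, e)] @ tword (rev u)) @ (tword u @ [(Sigma_gen s, \<not> e)] @ tword (rev u)) \<approx> []"
proof -
  have "(tword u @ [(Sigma_gen s, e)] @ tword (rev u)) @ (tword u @ [(Sigma_gen s, \<not> e)] @ tword (rev u))
     \<approx> tword u @ [(Sigma_gen s, e), (Sigma_gen s, \<not> e)] @ tword (rev u)"
    using cong_context[OF tword_rev_cancel'[OF assms(1)], of "tword u @ [(Sigma_gen s, e)]"
      "[(Sigma_gen s, \<not> e)] @ tword (rev u)"] assms by simp
  also have "\<dots> \<approx> tword u @ tword (rev u)"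
    using cong_context[OF cong_cancel, of "Sigma_gen s" "tword u" "tword (rev u)" e] assms by simp
  also have "\<dots> \<approx> []" using tword_rev_cancel assms by blast
  finally show ?thesis .
qed

lemma conj_parabolic_root:
  assumes "u \<in> lists S" "s \<in> S" "X \<subseteq> S" "rep u (sroot s) \<in> supported X"
  shows "\<exists>x\<in>lists X. \<exists>y\<in>X. length x \<le> length u \<and>
      tword u @ [(Sigma_gen s, e)] @ tword (rev u) \<approx> tword x @ [(Sigma_gen y, e)] @ tword (rev x)"
proof -
  obtain x y where xy: "x \<in> lists X" "y \<in> X" "length x \<le> len u"
    "tword u @ [sigma_letter s] @ tword (rev u) \<approx> tword x @ [sigma_letter y] @ tword (rev x)"
    using conj_parabolic_root_pos[OF assms] by blast
  have xS: "x \<in> lists S" "y \<in> S" using xy assms(3) by auto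
  have "tword u @ [(Sigma_gen s, False)] @ tword (rev u) \<approx> tword x @ [(Sigma_gen y, False)] @ tword (rev x)"
    by (rule cong_inverse_unique[OF xy(4)])
      (use conj_word_inverse[of u s True] conj_word_inverse[of x y False] assms xS in auto)
  then have "tword u @ [(Sigma_gen s, e)] @ tword (rev u) \<approx> tword x @ [(Sigma_gen y, e)] @ tword (rev x)"
    using xy(4) by (cases e) auto
  moreover have "len u \<le> length u" using len_le cong_refl assms by simp
  ultimately show ?thesis using xy le_trans by blast
qed

section \<open>Tau words that represent elements of the parabolic subgroup\<close>

lemma obtain_min_coset_rep:
  assumes "u \<in> lists S" "X \<subseteq> S"
  shows "\<exists>x\<in>lists X. \<exists>c\<in>lists S. length x \<le> len u \<and> tword u \<approx> tword (x @ c) \<and> (\<forall>a\<in>X. len c \<le> len (a # c))"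
  using assms(1)
proof (induction "len u" arbitrary: u rule: less_induct)
  case less
  show ?case
  proof (cases "\<exists>a\<in>X. len (a # u) < len u")
    case True
    then obtain a where a: "a \<in> X" "len (a # u) < len u" by blast
    have aS: "a \<in> S" using a assms by auto
    then obtain x c where xc: "x \<in> lists X" "c \<in> lists S" "length x \<le> len (a # u)"
      "tword (a # u) \<approx> tword (x @ c)" "\<forall>a\<in>X. len c \<le> len (a # c)"
      using less.hyps[OF a(2)] less.prems by auto
    have "tword u \<approx> tword (a # a # u)"
      using cong_context[OF cong_sym[OF tau_cancel[OF aS]], of "[]" "tword u"] less.prems by simp
    also have "tword (a # a # u) \<approx> tword ((a # x) @ c)"
      using cong_context[OF xc(4), of "[tau_letter a]" "[]"] aS by simp
    finally show ?thesis using xc a by (intro bexI[of _ "a # x"] bexI[of _ c]) auto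
  next
    case False
    then have "\<forall>a\<in>X. len u \<le> len (a # u)" by (auto simp: not_less)
    then show ?thesis
      using less.prems cong_refl by (intro bexI[of _ "[]"] bexI[of _ u]) auto
  qed
qed

lemma actK_outside:
  assumes "w \<in> words (va_gens X)" "i \<notin> X"
  shows "actK w v i = v i"
  using assms(1)
proof (induction w)
  case (Cons l w)
  obtain g e where l: "l = (g, e)" by (cases l)
  show ?case using Cons l assms(2) by (cases g) (auto simp: reflect_def sroot_def)
qed simp

text \<open>The inverse of c has no right descent at all. For s in X this is the minimality of c.
  For s outside X, c acts like a word over X and preserves the coordinate at s; hence c^-1(alpha_s)
  has coordinate 1 there and is not nonpositive.\<close>

lemma min_coset_rep_trivial:
  assumes "c \<in> lists S" "\<forall>a\<in>X. len c \<le> len (a # c)" "w \<in> words (va_gens X)" "tword c \<approx> w"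
  shows "tword c \<approx> []"
proof -
  have "len (rev c) \<le> len (rev c @ [s])" if s: "s \<in> S" for s
  proof (cases "s \<in> X")
    case True
    then show ?thesis using assms len_rev[of c] len_rev[of "s # c"] s by simp
  next
    case False
    let ?v = "rep (rev c) (sroot s)"
    have "?v s = actK w ?v s" using actK_outside assms(3) False by metis
    also have "\<dots> = rep c ?v s" using actK_cong[OF assms(4)] by simp
    also have "\<dots> = 1" using rep_rev_cancel' assms(1) by (simp add: sroot_def)
    finally have "\<not> nonneg (\<lambda>i. - ?v i)" unfolding nonneg_def by (metis neg_0_le_iff_le not_one_le_zero)
    then show ?thesis using rep_sroot_nonpos[of "rev c" s] assms(1) s by (meson in_lists_rev not_le)
  qed
  then have "len (rev c) = 0"
    using obtain_descent[of "rev c"] assms(1) by (metis in_lists_rev leD not_gr_zero)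
  then show ?thesis using len_eq_0 len_rev assms(1) by metis
qed

text \<open>Peeling off left descents in \<open>X\<close> leaves a factor that is again represented
  by a word over \<open>X\<close>, hence trivial. Each peeled letter shortens the element, so at
  most \<open>length u\<close> of them occur.\<close>

lemma tword_in_parabolic:
  assumes "u \<in> lists S" "X \<subseteq> S" "w \<in> words (va_gens X)" "tword u \<approx> w"
  shows "\<exists>x\<in>lists X. length x \<le> length u \<and> tword u \<approx> tword x"
proof -
  obtain x c where xc: "x \<in> lists X" "c \<in> lists S" "length x \<le> len u"
    "tword u \<approx> tword (x @ c)" "\<forall>a\<in>X. len c \<le> len (a # c)"
    using obtain_min_coset_rep[OF assms(1,2)] by blast
  have xS: "x \<in> lists S" using xc assms(2) by auto
  have "tword c \<approx> tword (rev x) @ tword x @ tword c"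
    using cong_context[OF cong_sym[OF tword_rev_cancel'[OF xS]], of "[]" "tword c"] xc by simp
  also have "\<dots> \<approx> tword (rev x) @ tword u"
    using cong_context[OF cong_sym[OF xc(4)], of "tword (rev x)" "[]"] xS by simp
  also have "\<dots> \<approx> tword (rev x) @ w"
    using cong_context[OF assms(4), of "tword (rev x)" "[]"] xS by simp
  finally have "tword c \<approx> []"
    using min_coset_rep_trivial[OF xc(2,5), of "tword (rev x) @ w"] xc(1) assms(3) by simp
  from cong_trans[OF xc(4)] cong_context[OF this, of "tword x" "[]"] xS
  have "tword u \<approx> tword x" by simp
  moreover have "len u \<le> length u" using len_le cong_refl assms by simp
  ultimately show ?thesis using xc le_trans by blast
qed

section \<open>The length bound\<close>

lemma tau_inverse: "s \<in> S \<Longrightarrow> [(Tau_gen s, e)] \<approx> [tau_letter s]"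
proof (cases e)
  case False
  assume s: "s \<in> S"
  have "[tau_letter s, (Tau_gen s, False)] \<approx> []"
    using cong_cancel[of "Tau_gen s" True] s by simp
  then show ?thesis
    using cong_inverse_unique[of "[tau_letter s]" "[tau_letter s]" "[(Tau_gen s, False)]" "[tau_letter s]"]
      tau_cancel s False cong_refl by simp
qed (simp add: cong_refl)

text \<open>The tau prefix \<open>u\<close> is carried along to the right. A tau letter lengthens it
  by one; a kept sigma letter emits its conjugate by \<open>u\<close>, which
  \<open>conj_parabolic_root\<close> replaces by at most \<open>2 * length u + 1\<close> letters
  over \<open>X\<close>. The prefix never outgrows \<open>length u + length w\<close>, whence the
  estimate.\<close>

lemma factor_retr:
  assumes "X \<subseteq> S" "w \<in> words (va_gens S)" "u \<in> lists S"
  shows "\<exists>y\<in>words (va_gens X). \<exists>u'\<in>lists S.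
    length y \<le> length w * (2 * (length u + length w) + 1) \<and> length u' \<le> length u + length w \<and>
    tword u @ retr {v. rep u v \<in> supported X} w \<approx> y @ tword u'"
  using assms(2,3)
proof (induction w arbitrary: u)
  case Nil
  then show ?case using cong_refl by (intro bexI[of _ "[]"] bexI[of _ u]) auto
next
  case (Cons l w)
  let ?K = "\<lambda>u. {v. rep u v \<in> supported X}"
  obtain g e where l: "l = (g, e)" by (cases l)
  have w: "w \<in> words (va_gens S)" using Cons.prems by simp
  have rw: "retr K w \<in> words (va_gens S)" for K using retr_words w .
  have tau: "\<exists>y\<in>words (va_gens X). \<exists>u'\<in>lists S.
      length y \<le> length (l # w) * (2 * (length u + length (l # w)) + 1) \<and>
      length u' \<le> length u + length (l # w) \<and>
      tword u @ (Tau_gen s, e) # retr (step (?K u) s) w \<approx> y @ tword u'" if s: "s \<in> S" for s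
  proof -
    \<comment> \<open>The invariant: the subspace in force is always the preimage of V_X under the
      prefix carried along.\<close>
    have K: "step (?K u) s = ?K (u @ [s])" by (auto simp: step_def)
    obtain y u' where y: "y \<in> words (va_gens X)" "u' \<in> lists S"
      "length y \<le> length w * (2 * (length (u @ [s]) + length w) + 1)"
      "length u' \<le> length (u @ [s]) + length w"
      "tword (u @ [s]) @ retr (?K (u @ [s])) w \<approx> y @ tword u'"
      using Cons.IH[OF w, of "u @ [s]"] Cons.prems s by auto
    have "tword u @ (Tau_gen s, e) # retr (?K (u @ [s])) w \<approx> tword (u @ [s]) @ retr (?K (u @ [s])) w"
      using cong_context[OF tau_inverse[OF s], of "tword u" "retr (?K (u @ [s])) w"] Cons.prems rw by simp
    also note y(5)
    finally have "tword u @ (Tau_gen s, e) # retr (step (?K u) s) w \<approx> y @ tword u'" unfolding K .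
    moreover have "length y \<le> length (l # w) * (2 * (length u + length (l # w)) + 1)"
      using y(3) by (simp add: algebra_simps)
    ultimately show ?thesis using y by (intro bexI[of _ y] bexI[of _ u']) auto
  qed
  show ?case
  proof (cases g)
    case (Tau_gen s)
    then show ?thesis using tau[of s] l Cons.prems by simp
  next
    case (Sigma_gen s)
    have s: "s \<in> S" using Cons.prems l Sigma_gen by simp
    show ?thesis
    proof (cases "sroot s \<in> ?K u")
      case False
      then show ?thesis using tau[OF s] l Sigma_gen by simp
    next
      case True
      then obtain x b where x: "x \<in> lists X" "b \<in> X" "length x \<le> length u"
        "tword u @ [(Sigma_gen s, e)] @ tword (rev u) \<approx> tword x @ [(Sigma_gen b, e)] @ tword (rev x)"
        using conj_parabolic_root[of u s X e] Cons.prems assms(1) s by auto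
      obtain y u' where y: "y \<in> words (va_gens X)" "u' \<in> lists S"
        "length y \<le> length w * (2 * (length u + length w) + 1)"
        "length u' \<le> length u + length w" "tword u @ retr (?K u) w \<approx> y @ tword u'"
        using Cons.IH[OF w, of u] Cons.prems by auto
      let ?c = "tword x @ [(Sigma_gen b, e)] @ tword (rev x)"
      have c: "?c \<in> words (va_gens X)" "?c \<in> words (va_gens S)"
        using x assms(1) by auto
      have "tword u @ (Sigma_gen s, e) # retr (?K u) w
          \<approx> (tword u @ [(Sigma_gen s, e)] @ tword (rev u)) @ tword u @ retr (?K u) w"
        using cong_context[OF cong_sym[OF tword_rev_cancel'], of u "tword u @ [(Sigma_gen s, e)]" "retr (?K u) w"]
          Cons.prems s rw by simp
      also have "\<dots> \<approx> ?c @ y @ tword u'"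
        using cong_append[OF x(4) y(5)] by simp
      finally have "tword u @ retr (?K u) (l # w) \<approx> (?c @ y) @ tword u'"
        using True l Sigma_gen by simp
      moreover have "length (?c @ y) \<le> length (l # w) * (2 * (length u + length (l # w)) + 1)"
        using y(3) x(3) by (simp add: algebra_simps)
      ultimately show ?thesis using c y by (intro bexI[of _ "?c @ y"] bexI[of _ u']) auto
    qed
  qed
qed

text \<open>The remainder left by \<open>factor_retr\<close> is congruent to y^-1 x, a word over X,
  so \<open>tword_in_parabolic\<close> replaces it by tau letters of X without lengthening
  it.\<close>

lemma parabolic_word_bound:
  assumes "X \<subseteq> S" "w \<approx> x" "x \<in> words (va_gens X)"
  shows "\<exists>v\<in>words (va_gens X). w \<approx> v \<and> length v \<le> 2 * (length w * length w) + 2 * length w"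
proof -
  have w: "w \<in> words (va_gens S)" using cong_words assms(2) by blast
  have "supported X = {v. rep [] v \<in> supported X}" by simp
  then obtain y u where y: "y \<in> words (va_gens X)" "u \<in> lists S" "length y \<le> length w * (2 * length w + 1)"
    "length u \<le> length w" "retr (supported X) w \<approx> y @ tword u"
    using factor_retr[OF assms(1) w, of "[]"] by auto
  have wy: "w \<approx> y @ tword u" using cong_retr_supported[OF assms(1,3,2)] y(5) cong_trans by blast
  let ?y' = "map (apsnd Not) (rev y)"
  have yS: "y \<in> words (va_gens S)" "?y' \<in> words (va_gens S)"
    using cong_words[OF y(5)] by auto
  have "tword u \<approx> (?y' @ y) @ tword u"
    using cong_context[OF cong_sym[OF cong_inverse[OF yS(1)]], of "[]" "tword u"] y by simp
  also have "\<dots> \<approx> ?y' @ w" using cong_context[OF cong_sym[OF wy], of ?y' "[]"] yS by simp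
  also have "\<dots> \<approx> ?y' @ x" using cong_context[OF assms(2), of ?y' "[]"] yS by simp
  finally obtain z where z: "z \<in> lists X" "length z \<le> length u" "tword u \<approx> tword z"
    using tword_in_parabolic[OF y(2) assms(1), of "?y' @ x"] y(1) assms(3) by auto
  have "w \<approx> y @ tword z"
    using cong_trans[OF wy] cong_context[OF z(3), of y "[]"] yS by simp
  moreover have "length (y @ tword z) \<le> 2 * (length w * length w) + 2 * length w"
    using y z by (simp add: algebra_simps)
  ultimately show ?thesis using y z by (intro bexI[of _ "y @ tword z"]) auto
qed

section \<open>Solving the strong membership problem\<close>

abbreviation cls :: "('s va_gen \<times> bool) list \<Rightarrow> ('s va_gen \<times> bool) list set" where
  "cls w \<equiv> pres_cong (va_gens S) (va_rels S M) `` {w}"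

lemma cls_eq_iff: "u \<in> words (va_gens S) \<Longrightarrow> v \<in> words (va_gens S) \<Longrightarrow> cls u = cls v \<longleftrightarrow> u \<approx> v"
  by (simp add: pres_cong_class_eq_iff cong_def)

lemma mult_cls: "u \<in> words (va_gens S) \<Longrightarrow> v \<in> words (va_gens S) \<Longrightarrow> cls u \<otimes>\<^bsub>VA S M\<^esub> cls v = cls (u @ v)"
  by (simp add: VA_def mult_presented_group)

lemma one_cls: "\<one>\<^bsub>VA S M\<^esub> = cls []"
  by (simp add: VA_def one_presented_group)

lemma cls_carrier: "w \<in> words (va_gens S) \<Longrightarrow> cls w \<in> carrier (VA S M)"
  by (auto simp: VA_def carrier_presented_group)

lemma letter_val_cls:
  assumes "g \<in> va_gens S"
  shows "letter_val (VA S M) (va_elt S M g, e) = cls [(g, e)]"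
proof (cases e)
  case True
  then show ?thesis by (simp add: letter_val_def va_elt_def)
next
  case False
  interpret group "VA S M" by (rule group_VA)
  have "cls [(g, False)] \<otimes>\<^bsub>VA S M\<^esub> va_elt S M g = \<one>\<^bsub>VA S M\<^esub>"
    using assms cong_cancel[of g False] by (simp add: va_elt_def mult_cls one_cls cls_eq_iff)
  then have "inv\<^bsub>VA S M\<^esub> va_elt S M g = cls [(g, False)]"
    using assms by (intro inv_equality) (simp_all add: va_elt_def cls_carrier)
  then show ?thesis using False by (simp add: letter_val_def)
qed

lemma word_val_cls:
  "u \<in> words (va_gens S) \<Longrightarrow> word_val (VA S M) (map (apfst (va_elt S M)) u) = cls u"
proof (induction u)
  case Nil
  show ?case by (simp add: word_val_def one_cls)
next
  case (Cons l u)
  obtain g e where "l = (g, e)" by (cases l)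
  then show ?case using Cons letter_val_cls[of g e] by (simp add: word_val_def mult_cls)
qed

lemma va_gens_mono: "X \<subseteq> S \<Longrightarrow> u \<in> words (va_gens X) \<Longrightarrow> u \<in> words (va_gens S)"
  by (induction u) (auto simp: va_gens_def)

lemma VA_sub_iff:
  assumes "X \<subseteq> S"
  shows "h \<in> VA_sub S M X \<longleftrightarrow> (\<exists>x\<in>words (va_gens X). h = cls x)"
proof
  assume "h \<in> VA_sub S M X"
  then have "h \<in> generate (VA S M) (va_generators S M X)" by (simp add: VA_sub_def)
  then show "\<exists>x\<in>words (va_gens X). h = cls x"
  proof (induction rule: generate.induct)
    case one
    then show ?case using one_cls by (intro bexI[of _ "[]"]) auto
  next
    case (incl h)
    then obtain g where "g \<in> va_gens X" "h = va_elt S M g" by (auto simp: va_generators_def)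
    then show ?case by (intro bexI[of _ "[(g, True)]"]) (auto simp: va_elt_def)
  next
    case (inv h)
    then obtain g where g: "g \<in> va_gens X" "h = va_elt S M g" by (auto simp: va_generators_def)
    then have "g \<in> va_gens S" using assms by (auto simp: va_gens_def)
    then show ?case using letter_val_cls[of g False] g
      by (intro bexI[of _ "[(g, False)]"]) (auto simp: letter_val_def)
  next
    case (eng h1 h2)
    then obtain x y where "x \<in> words (va_gens X)" "h1 = cls x" "y \<in> words (va_gens X)" "h2 = cls y" by blast
    then show ?case using mult_cls va_gens_mono[OF assms] by (intro bexI[of _ "x @ y"]) auto
  qed
next
  have "cls x \<in> generate (VA S M) (va_generators S M X)" if "x \<in> words (va_gens X)" for x
    using that
  proof (induction x)
    case Nil
    show ?case using generate.one[of "VA S M"] by (simp add: one_cls)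
  next
    case (Cons l x)
    obtain g e where l: "l = (g, e)" by (cases l)
    have g: "g \<in> va_gens X" using Cons.prems l by simp
    then have gS: "g \<in> va_gens S" using assms by (auto simp: va_gens_def)
    have "va_elt S M g \<in> va_generators S M X" using g by (simp add: va_generators_def)
    then have "cls [(g, e)] \<in> generate (VA S M) (va_generators S M X)"
      using letter_val_cls[OF gS, of e] generate.incl generate.inv
      by (metis fst_conv letter_val_def)
    from generate.eng[OF this] have "cls [(g, e)] \<otimes>\<^bsub>VA S M\<^esub> cls x \<in> generate (VA S M) (va_generators S M X)"
      using Cons by simp
    then show ?case using gS Cons.prems va_gens_mono[OF assms] l by (simp add: mult_cls)
  qed
  then show "\<exists>x\<in>words (va_gens X). h = cls x \<Longrightarrow> h \<in> VA_sub S M X"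
    by (auto simp: VA_sub_def)
qed

text \<open>In the decision problem the letters are elements of VA, that is, classes of words.
  Choosing a formal generator for each letter works even if several formal generators represent the
  same element.\<close>

lemma obtain_va_word:
  assumes "w \<in> words (va_generators S M X)" "X \<subseteq> S"
  obtains u where "u \<in> words (va_gens X)" "w = map (apfst (va_elt S M)) u" "length u = length w"
    "word_val (VA S M) w = cls u"
  using assms word_val_cls va_gens_mono[OF assms(2)] by (fastforce simp: va_generators_def words_image_iff)

lemma word_val_quotient:
  assumes "w \<in> words (va_generators S M S)" "v \<in> words (va_generators S M S)"
  shows "word_val (VA S M) (map (apsnd Not) (rev v) @ w) = \<one>\<^bsub>VA S M\<^esub> \<longleftrightarrow>
    word_val (VA S M) v = word_val (VA S M) w"
proof -
  obtain x where x: "x \<in> words (va_gens S)" "w = map (apfst (va_elt S M)) x" "word_val (VA S M) w = cls x"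
    using obtain_va_word[OF assms(1)] by blast
  obtain y where y: "y \<in> words (va_gens S)" "v = map (apfst (va_elt S M)) y" "word_val (VA S M) v = cls y"
    using obtain_va_word[OF assms(2)] by blast
  let ?y' = "map (apsnd Not) (rev y)"
  have y': "?y' \<in> words (va_gens S)" "?y' @ y \<approx> []" using y cong_inverse by auto
  have "map (apsnd Not) (rev v) @ w = map (apfst (va_elt S M)) (?y' @ x)"
    by (simp add: x y rev_map apfst_apsnd)
  then have "word_val (VA S M) (map (apsnd Not) (rev v) @ w) = cls (?y' @ x)"
    using word_val_cls[of "?y' @ x"] x y' by simp
  moreover have "?y' @ x \<approx> [] \<longleftrightarrow> y \<approx> x"
  proof
    assume a: "?y' @ x \<approx> []"
    have "map (apsnd Not) (map (apsnd Not) y) = y" by (induction y) auto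
    then have yy: "y @ ?y' \<approx> []" using cong_inverse[OF y'(1)] by (simp add: rev_map del: map_map)
    have "x \<approx> (y @ ?y') @ x" using cong_context[OF cong_sym[OF yy], of "[]" x] x by simp
    also have "(y @ ?y') @ x \<approx> y" using cong_context[OF a, of y "[]"] y by simp
    finally show "y \<approx> x" by (rule cong_sym)
  next
    assume "y \<approx> x"
    from cong_context[OF cong_sym[OF this], of ?y' "[]"] y' have "?y' @ x \<approx> ?y' @ y" by simp
    then show "?y' @ x \<approx> []" using y'(2) by (rule cong_trans)
  qed
  ultimately show ?thesis using x y y' by (simp add: one_cls cls_eq_iff)
qed

end

theorem theorem1p6:
  fixes S X :: "'s set" and M :: "'s \<Rightarrow> 's \<Rightarrow> enat"
  assumes "finite S"
    and "coxeter_matrix S M"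
    and "X \<subseteq> S"
    and "word_problem_solvable (VA S M) (va_generators S M S)"
  shows "strong_membership_solvable (VA S M) (va_generators S M S)
           (VA_sub S M X) (va_generators S M X)"
proof (cases "X = {}")
  \<comment> \<open>The search clips invalid codes to a letter of the subgroup, so an empty
    \<open>X\<close> is treated apart. The word problem program then already gives the required
    answers: its output 1 is the successor of the code of the empty word.\<close>
  case True
  have H: "VA_sub S M X = {\<one>\<^bsub>VA S M\<^esub>}"
    using True group.generate_empty[OF group_VA] by (simp add: VA_sub_def va_generators_def va_gens_def)
  obtain p where p: "\<And>w. w \<in> words (va_generators S M S) \<Longrightarrow>
      computes p [word_code (va_generators S M S) w] (if word_val (VA S M) w = \<one>\<^bsub>VA S M\<^esub> then 1 else 0)"
    using assms(4) unfolding word_problem_solvable_def by blast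
  have empty: "word_val (VA S M) [] = \<one>\<^bsub>VA S M\<^esub>" "word_code (va_generators S M X) [] = 0"
    by (simp_all add: word_val_def word_code_def)
  show ?thesis
    unfolding strong_membership_solvable_def H
  proof (intro exI[of _ p] ballI conjI impI)
    fix w assume w: "w \<in> words (va_generators S M S)"
    show "\<exists>v\<in>words (va_generators S M X). word_val (VA S M) v = word_val (VA S M) w \<and>
        computes p [word_code (va_generators S M S) w] (Suc (word_code (va_generators S M X) v))"
      if "word_val (VA S M) w \<in> {\<one>\<^bsub>VA S M\<^esub>}"
      using that p[OF w] empty by (intro bexI[of _ "[]"]) simp_all
    show "computes p [word_code (va_generators S M S) w] 0"
      if "word_val (VA S M) w \<notin> {\<one>\<^bsub>VA S M\<^esub>}"
      using that p[OF w] by simp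
  qed
next
  case False
  interpret coxeter_data S M by unfold_locales (fact assms)+
  have sub: "va_generators S M X \<subseteq> va_generators S M S" "va_generators S M X \<noteq> {}"
    using assms(3) False by (auto simp: va_generators_def va_gens_def)
  show ?thesis
  proof (rule strong_membership_of_bound[OF finite_va_generators[OF assms(1)] _ sub assms(4) word_val_quotient])
    show "va_generators S M S \<noteq> {}" using sub by blast
    show "word_val (VA S M) v \<in> VA_sub S M X" if "v \<in> words (va_generators S M X)" for v
      using obtain_va_word[OF that assms(3)] VA_sub_iff[OF assms(3)] by metis
    show "\<exists>v\<in>words (va_generators S M X). word_val (VA S M) v = word_val (VA S M) w \<and>
        length v \<le> 4 * triangle (length w)"
      if w: "w \<in> words (va_generators S M S)" and H: "word_val (VA S M) w \<in> VA_sub S M X" for w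
    proof -
      obtain u where u: "u \<in> words (va_gens S)" "length u = length w" "word_val (VA S M) w = cls u"
        using obtain_va_word[OF w] by blast
      obtain x where x: "x \<in> words (va_gens X)" "cls u = cls x"
        using H VA_sub_iff[OF assms(3)] u by metis
      then have "u \<approx> x" using cls_eq_iff u va_gens_mono[OF assms(3)] by blast
      then obtain v where v: "v \<in> words (va_gens X)" "u \<approx> v"
        "length v \<le> 2 * (length u * length u) + 2 * length u"
        using parabolic_word_bound[OF assms(3) _ x(1)] by blast
      have vS: "v \<in> words (va_gens S)" using va_gens_mono[OF assms(3) v(1)] .
      have "map (apfst (va_elt S M)) v \<in> words (va_generators S M X)"
        using v(1) by (auto simp: va_generators_def words_image_iff)
      moreover have "word_val (VA S M) (map (apfst (va_elt S M)) v) = word_val (VA S M) w"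
        using word_val_cls[OF vS] u v(2) cls_eq_iff[OF u(1) vS] by simp
      ultimately show ?thesis using v(3) u(2) by (intro bexI) (auto simp: four_triangle)
    qed
  qed
qed

end
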